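(* Let $n\ge 1$ and consider any homogeneous Kuramoto model on the complete network on $n$ nodes (with any common natural frequency and any coupling constant $k>0$). Then the zero fixed point solution has a basin of attraction consisting of the entire space of initial phases minus a set of measure zero.
   Context: The Kuramoto model on a finite simple undirected network with nodes $1,\ldots,n$ and symmetric $0/1$ adjacency matrix $A=(A_{ij})$ (with $A_{ii}=0$) is the system $$\dot\theta_i=\omega_i+k\sum_{j=1}^n A_{ij}\sin(\theta_j-\theta_i),\qquad i=1,\ldots,n,$$ where the $\theta_i=\theta_i(t)$ are phase angles, the real constants $\omega_i$ are natural frequencies, and $k>0$ is the coupling constant. The model is homogeneous if all the $\omega_i$ are equal. The complete network is the one with $A_{ij}=1$ for all $i\ne j$. A fixed point (frequency fixed point) is a solution with $\dot\theta_i(t)=\bar\omega$ for all $i$ and $t$, where $\bar\omega=\frac1n\sum_j\omega_j$. The zero fixed point is the fixed point in which all phase angle differences $\theta_j-\theta_i$ are zero (modulo $2\pi$). The space of initial phases is the set of all $(\theta_1(0),\ldots,\theta_n(0))$ with angles over the full range $-\pi$ to $\pi$ (the $n$-torus $(\mathbb{R}/2\pi\mathbb{Z})^n$), with Lebesgue measure. The basin of attraction of the zero fixed point is the set of initial phases for which the solution satisfies $\theta_j(t)-\theta_i(t)\to 0$ modulo $2\pi$ as $t\to\infty$ for all $i,j$. *)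

theory Defs
  imports "HOL-Analysis.Analysis"
begin

text \<open>
  The nodes are the elements of a finite type, so \<open>n = CARD('n) \<ge> 1\<close>. A network is given by its
  adjacency matrix.
\<close>

definition network :: "real ^ 'n ^ 'n \<Rightarrow> bool" where
  "network A \<longleftrightarrow>
     (\<forall>i j. A $ i $ j \<in> {0, 1}) \<and> (\<forall>i j. A $ i $ j = A $ j $ i) \<and> (\<forall>i. A $ i $ i = 0)"

definition complete_network :: "real ^ 'n ^ 'n \<Rightarrow> bool" where
  "complete_network A \<longleftrightarrow> network A \<and> (\<forall>i j. i \<noteq> j \<longrightarrow> A $ i $ j = 1)"

definition homogeneous :: "real ^ 'n \<Rightarrow> bool" where
  "homogeneous \<omega> \<longleftrightarrow> (\<forall>i j. \<omega> $ i = \<omega> $ j)"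

text \<open>
  Solutions are lifted from the torus to the universal cover: a trajectory takes values in
  \<open>real ^ 'n\<close> and its components are read modulo \<open>2\<pi>\<close>. Time runs over \<open>t \<ge> 0\<close>; the derivative
  at \<open>0\<close> is one-sided.
\<close>

definition kuramoto_solution ::
  "real ^ 'n \<Rightarrow> real \<Rightarrow> real ^ 'n ^ 'n \<Rightarrow> (real \<Rightarrow> real ^ 'n::finite) \<Rightarrow> bool" where
  "kuramoto_solution \<omega> k A \<theta> \<longleftrightarrow>
     (\<forall>t\<ge>0. \<forall>i. ((\<lambda>s. \<theta> s $ i) has_real_derivative
        (\<omega> $ i + k * (\<Sum>j\<in>UNIV. A $ i $ j * sin (\<theta> t $ j - \<theta> t $ i)))) (at t within {0..}))"

definition mean_frequency :: "real ^ 'n::finite \<Rightarrow> real" where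
  "mean_frequency \<omega> = (\<Sum>j\<in>UNIV. \<omega> $ j) / real CARD('n)"

definition fixed_point ::
  "real ^ 'n \<Rightarrow> real \<Rightarrow> real ^ 'n ^ 'n \<Rightarrow> (real \<Rightarrow> real ^ 'n::finite) \<Rightarrow> bool" where
  "fixed_point \<omega> k A \<theta> \<longleftrightarrow> kuramoto_solution \<omega> k A \<theta> \<and>
     (\<forall>t\<ge>0. \<forall>i. ((\<lambda>s. \<theta> s $ i) has_real_derivative mean_frequency \<omega>) (at t within {0..}))"

definition zero_fixed_point ::
  "real ^ 'n \<Rightarrow> real \<Rightarrow> real ^ 'n ^ 'n \<Rightarrow> (real \<Rightarrow> real ^ 'n::finite) \<Rightarrow> bool" where
  "zero_fixed_point \<omega> k A \<theta> \<longleftrightarrow> fixed_point \<omega> k A \<theta> \<and>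
     (\<forall>t\<ge>0. \<forall>i j. \<exists>m::int. \<theta> t $ j - \<theta> t $ i = 2 * pi * of_int m)"

text \<open>The \<open>n\<close>-torus, represented by its fundamental domain \<open>(-\<pi>, \<pi>]\<^sup>n\<close>.\<close>

definition phase_space :: "(real ^ 'n) set" where
  "phase_space = {x. \<forall>i. - pi < x $ i \<and> x $ i \<le> pi}"

text \<open>
  Convergence to \<open>0\<close> in \<open>\<real> / 2\<pi>\<int>\<close>: the distance to the nearest multiple of \<open>2\<pi>\<close> tends to \<open>0\<close>.
\<close>

definition tends_to_zero_mod_2pi :: "(real \<Rightarrow> real) \<Rightarrow> bool" where
  "tends_to_zero_mod_2pi f \<longleftrightarrow>
     (\<forall>\<epsilon>>0. \<forall>\<^sub>F t in at_top. \<exists>m::int. \<bar>f t - 2 * pi * of_int m\<bar> < \<epsilon>)"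

text \<open>
  Initial phases for which \<^emph>\<open>the\<close> solution synchronises: a solution starting there exists, and
  every solution starting there synchronises. The vector field is globally Lipschitz, so
  solutions exist and are unique on \<open>t \<ge> 0\<close>.
\<close>

definition zero_basin ::
  "real ^ 'n \<Rightarrow> real \<Rightarrow> real ^ 'n ^ 'n \<Rightarrow> (real ^ 'n::finite) set" where
  "zero_basin \<omega> k A = {x \<in> phase_space.
     (\<exists>\<theta>. kuramoto_solution \<omega> k A \<theta> \<and> \<theta> 0 = x) \<and>
     (\<forall>\<theta>. kuramoto_solution \<omega> k A \<theta> \<and> \<theta> 0 = x \<longrightarrow>
        (\<forall>i j. tends_to_zero_mod_2pi (\<lambda>t. \<theta> t $ j - \<theta> t $ i)))}"

end

theory Submission
  imports Defs
begin

text \<open>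
  On the complete network every phase feels only the total phasor \<open>Z = \<Sum>\<^sub>j exp (i \<theta>\<^sub>j)\<close>: the
  coupling term of node \<open>i\<close> is \<open>k q\<^sub>i\<close> with \<open>q\<^sub>i = Im (Z exp (- i \<theta>\<^sub>i))\<close>. The squared length of
  \<open>Z\<close> is a Lyapunov function, because its derivative is \<open>2 k \<Sum>\<^sub>i q\<^sub>i\<^sup>2\<close>. It is bounded, so all
  \<open>q\<^sub>i\<close> tend to \<open>0\<close>; if \<open>Z\<close> does not vanish at time \<open>0\<close>, then it stays away from \<open>0\<close>, each phase
  becomes parallel or antiparallel to \<open>Z\<close>, and every phase difference converges to a multiple of \<open>\<pi>\<close>
  (\<open>phase_differences_converge\<close>). The limit is synchrony unless some, but fewer than half, of the
  phases end up opposite to the majority.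

  It remains to see that initial phases ending in such a partly antiphase state \<open>c\<close>
  are rare. The antiphase states are saddles, and the direction in which a single minority phase
  is moved lies in their expanding cone: for two solutions that stay close to \<open>c\<close> for
  all times, the indefinite quadratic form \<open>E = - \<Sum>\<^sub>i cos c\<^sub>i
  d\<^sub>i\<^sup>2\<close> of their difference \<open>d\<close>, reduced to mean
  \<open>0\<close>, satisfies \<open>E' \<ge> k \<Sum>\<^sub>i d\<^sub>i\<^sup>2 \<ge> k
  E\<close>. If the solutions start with different values of one minority phase and equal values
  of all others, then \<open>E > 0\<close> at the start and \<open>E\<close> is unbounded,
  although \<open>d\<close> stays bounded as long as both solutions are close to \<open>c\<close>
  (\<open>saddle_repulsion\<close>). So the closed set of points whose solution stays close to
  \<open>c\<close> meets each line in that direction at most once, its translates along the line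
  are pairwise disjoint, and it is a null set (\<open>negligible_captured\<close>). A bad initial
  point reaches one of these countably many null sets at an integer time; going back in time is a
  Lipschitz map by Gronwall's inequality, so the bad points form a null set as well. The points
  with \<open>Z = 0\<close> form a null set by the same translation argument
  (\<open>negligible_incoherent\<close>).

  Existence of solutions comes from the contraction principle in a weighted supremum norm.
\<close>

section \<open>Real functions on the half-line\<close>

lemma nondecreasing_if_derivative_nonneg:
  fixes f :: "real \<Rightarrow> real"
  assumes der: "\<And>t. t \<ge> 0 \<Longrightarrow> (f has_real_derivative f' t) (at t within {0..})"
    and nn: "\<And>t. t \<ge> 0 \<Longrightarrow> f' t \<ge> 0" and st: "0 \<le> s" "s \<le> t"
  shows "f s \<le> f t"
proof (rule DERIV_nonneg_imp_increasing_open[OF st(2)])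
  fix x assume x: "s < x" "x < t"
  have "at x within {0..} = at x" by (rule at_within_interior) (use x st in auto)
  then show "\<exists>y. DERIV f x :> y \<and> y \<ge> 0" using der[of x] nn[of x] x st by auto
next
  have "continuous_on {0..} f"
    by (metis DERIV_continuous_on atLeast_iff der)
  then show "continuous_on {s..t} f" by (rule continuous_on_subset) (use st in auto)
qed

text \<open>
  The integrating factors \<open>exp (\<plusminus> 2 L t)\<close> turn the differential inequality into monotonicity. The
  factor is written as a square because \<open>D\<close> is meant to be a squared distance.
\<close>

lemma gronwall_two_sided:
  fixes D :: "real \<Rightarrow> real"
  assumes der: "\<And>t. t \<ge> 0 \<Longrightarrow> (D has_real_derivative D' t) (at t within {0..})"
    and bnd: "\<And>t. \<bar>D' t\<bar> \<le> 2 * L * D t" and t: "t \<ge> 0"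
  shows "D t \<le> (exp (L * t))\<^sup>2 * D 0" and "D 0 \<le> (exp (L * t))\<^sup>2 * D t"
proof -
  have e2: "exp (2 * L * t) = (exp (L * t))\<^sup>2"
    by (simp add: power2_eq_square flip: exp_add)
  have der_exp: "((\<lambda>t. \<epsilon> * (exp (c * t) * D t)) has_real_derivative \<epsilon> * (exp (c * t) * (c * D t + D' t)))
      (at t within {0..})" if "t \<ge> 0" for c \<epsilon> t
    using der[OF that] by (auto intro!: derivative_eq_intros simp: algebra_simps)
  have "(-1) * (exp (- (2 * L) * 0) * D 0) \<le> (-1) * (exp (- (2 * L) * t) * D t)"
  proof (rule nondecreasing_if_derivative_nonneg[OF der_exp])
    fix t
    have "D' t \<le> 2 * L * D t" using bnd[of t] by linarith
    then show "0 \<le> (-1) * (exp (- (2 * L) * t) * (- (2 * L) * D t + D' t))"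
      by (simp add: mult_le_0_iff)
  qed (use t in auto)
  then have "inverse ((exp (L * t))\<^sup>2) * D t \<le> D 0" by (simp add: exp_minus e2)
  then show "D t \<le> (exp (L * t))\<^sup>2 * D 0" by (simp add: field_simps)
  have "1 * (exp ((2 * L) * 0) * D 0) \<le> 1 * (exp ((2 * L) * t) * D t)"
  proof (rule nondecreasing_if_derivative_nonneg[OF der_exp])
    fix t
    have "0 \<le> 2 * L * D t + D' t" using bnd[of t] by linarith
    then show "0 \<le> 1 * (exp (2 * L * t) * (2 * L * D t + D' t))" by simp
  qed (use t in auto)
  then show "D 0 \<le> (exp (L * t))\<^sup>2 * D t" by (simp add: e2)
qed

text \<open>
  Barbalat's lemma. An increasing bounded function gains arbitrarily little over late windows
  of fixed length, while a Lipschitz derivative that is large once stays large on such a window.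
\<close>

lemma barbalat:
  fixes V g :: "real \<Rightarrow> real"
  assumes der: "\<And>t. t \<ge> 0 \<Longrightarrow> (V has_real_derivative g t) (at t within {0..})"
    and g0: "\<And>t. t \<ge> 0 \<Longrightarrow> g t \<ge> 0" and bdd: "\<And>t. t \<ge> 0 \<Longrightarrow> V t \<le> B"
    and lip: "\<And>s t. 0 \<le> s \<Longrightarrow> s \<le> t \<Longrightarrow> \<bar>g t - g s\<bar> \<le> M * (t - s)"
  shows "(g \<longlongrightarrow> 0) at_top"
proof (rule tendstoI)
  fix e :: real assume e: "e > 0"
  have mvt: "\<exists>\<xi>. s < \<xi> \<and> \<xi> < t \<and> V t - V s = (t - s) * g \<xi>" if "0 \<le> s" "s < t" for s t
  proof -
    have "(V has_derivative (\<lambda>h. g \<xi> * h)) (at \<xi> within {s..t})" if "s \<le> \<xi>" "\<xi> \<le> t" for \<xi>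
      using DERIV_subset[OF der[of \<xi>], of "{s..t}"] that \<open>0 \<le> s\<close>
      by (auto simp: has_field_derivative_def)
    from mvt_simple[OF \<open>s < t\<close> this] obtain \<xi> where
      "\<xi> \<in> {s<..<t}" "V t - V s = g \<xi> * (t - s)" by auto
    then show ?thesis by (intro exI[of _ \<xi>]) (simp add: mult.commute)
  qed
  have mono: "V s \<le> V t" if "0 \<le> s" "s \<le> t" for s t
    by (rule nondecreasing_if_derivative_nonneg[OF der g0 that])
  (* On a window of this length g drops by less than e/2, so a value g t \<ge> e at its left end
     would raise V by more than h * e / 2. *)
  define h where "h = e / (2 * (\<bar>M\<bar> + 1))"
  have h: "h > 0" "\<bar>M\<bar> * h < e / 2" using e by (auto simp: h_def field_simps add_pos_nonneg)
  define l where "l = (SUP t\<in>{0..}. V t)"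
  have bd: "bdd_above (V ` {0..})" using bdd by (auto intro!: bdd_aboveI)
  have "l - h * e / 2 < l" using h e by simp
  then obtain T where T: "T \<ge> 0" "l - h * e / 2 < V T"
    unfolding l_def using less_cSUP_iff[OF _ bd] by auto
  have "dist (g t) 0 < e" if "t \<ge> T" for t
  proof -
    have t0: "t \<ge> 0" using T that by simp
    have "t < t + h" using h by simp
    from mvt[OF t0 this] obtain \<xi> where \<xi>: "t < \<xi>" "\<xi> < t + h" "V (t + h) - V t = h * g \<xi>" by auto
    have "V (t + h) \<le> l" unfolding l_def by (rule cSUP_upper[OF _ bd]) (use h T that in auto)
    moreover have "V T \<le> V t" using mono T that by auto
    ultimately have "V (t + h) - V t < h * e / 2" using T by linarith
    then have "h * g \<xi> < h * (e / 2)" using \<xi> by (metis times_divide_eq_right)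
    then have "g \<xi> < e / 2" using h(1) by (simp only: mult_less_cancel_left_pos)
    moreover have "\<bar>g \<xi> - g t\<bar> \<le> M * (\<xi> - t)" using lip[of t \<xi>] \<xi> T that by simp
    moreover have "M * (\<xi> - t) \<le> \<bar>M\<bar> * h" using \<xi> by (intro mult_mono) auto
    ultimately have "g t < e" using h by linarith
    then show ?thesis using g0[of t] T that by simp
  qed
  then show "\<forall>\<^sub>F t in at_top. dist (g t) 0 < e"
    by (auto simp: eventually_at_top_linorder)
qed

text \<open>
  Continuity forbids a function with small sine to move from one multiple of \<open>\<pi>\<close> to another.
\<close>

lemma sin_tendsto_zero_imp_tendsto:
  fixes f :: "real \<Rightarrow> real"
  assumes cont: "continuous_on {0..} f" and lim: "((\<lambda>t. sin (f t)) \<longlongrightarrow> 0) at_top"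
  shows "\<exists>m::int. (f \<longlongrightarrow> pi * of_int m) at_top"
proof -
  have "\<forall>\<^sub>F t in at_top. \<bar>sin (f t)\<bar> < 1"
    using tendstoD[OF lim, of 1] by simp
  then obtain T0 where T0: "\<And>t. t \<ge> T0 \<Longrightarrow> \<bar>sin (f t)\<bar> < 1"
    by (auto simp: eventually_at_top_linorder)
  define T where "T = max 0 T0"
  have sT: "\<bar>sin (f t)\<bar> < 1" if "t \<ge> T" for t using T0[of t] that by (auto simp: T_def)
  have contT: "continuous_on {T..t} f" for t
    by (rule continuous_on_subset[OF cont]) (auto simp: T_def)
  (* Once sin f avoids 1 and -1, f is trapped between consecutive odd multiples of pi/2, where
     sine is invertible up to sign. *)
  define m where "m = round (f T / pi)"
  define g where "g t = f t - pi * of_int m" for t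
  have sing: "sin (g t) = cos (pi * of_int m) * sin (f t)" for t
    unfolding g_def by (simp add: sin_diff sin_npi_int mult.commute[of "sin (f t)"])
  have cm: "\<bar>cos (pi * of_int m)\<bar> = 1"
    by (rule sin_zero_abs_cos_one) (rule sin_npi_int)
  have contg: "continuous_on {T..t} g" for t unfolding g_def by (intro continuous_intros contT)
  have ne: "\<bar>g t\<bar> \<noteq> pi / 2" if "t \<ge> T" for t
  proof
    assume "\<bar>g t\<bar> = pi / 2"
    then have "g t = pi / 2 \<or> g t = - (pi / 2)" by linarith
    then have "sin (g t) = 1 \<or> sin (g t) = - 1" by (metis sin_minus sin_pi_half)
    then have "\<bar>sin (g t)\<bar> = 1" by auto
    then show False using sT[OF that] cm by (simp only: sing abs_mult)
  qed
  have gT: "\<bar>g T\<bar> \<le> pi / 2"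
  proof -
    have "\<bar>of_int (round (f T / pi)) - f T / pi\<bar> \<le> 1 / 2" by (rule of_int_round_abs_le)
    then have "\<bar>of_int m - f T / pi\<bar> * pi \<le> 1 / 2 * pi" unfolding m_def by (rule mult_right_mono) simp
    then have "\<bar>(of_int m - f T / pi) * pi\<bar> \<le> pi / 2" by (simp add: abs_mult)
    then show ?thesis by (simp add: g_def algebra_simps abs_minus_commute)
  qed
  have gb: "\<bar>g t\<bar> < pi / 2" if t: "t \<ge> T" for t
  proof (rule ccontr)
    assume "\<not> \<bar>g t\<bar> < pi / 2"
    then obtain s where "s \<ge> T" "\<bar>g s\<bar> = pi / 2"
      using IVT'[OF gT _ t continuous_on_rabs[OF contg[of t]]] by (metis linorder_not_less)
    then show False using ne by blast
  qed
  have "((\<lambda>t. sin (g t)) \<longlongrightarrow> cos (pi * of_int m) * 0) at_top"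
    unfolding sing by (intro tendsto_intros lim)
  then have "((\<lambda>t. arcsin (sin (g t))) \<longlongrightarrow> arcsin 0) at_top"
    by (intro isCont_tendsto_compose[OF isCont_arcsin]) auto
  moreover have "\<forall>\<^sub>F t in at_top. arcsin (sin (g t)) = g t"
    using eventually_ge_at_top[of T]
  proof eventually_elim
    case (elim t) show ?case using gb[OF elim] by (intro arcsin_sin) auto
  qed
  ultimately have "(g \<longlongrightarrow> 0) at_top" by (simp add: tendsto_cong)
  then have "((\<lambda>t. g t + pi * of_int m) \<longlongrightarrow> 0 + pi * of_int m) at_top" by (intro tendsto_intros)
  then show ?thesis by (auto simp: g_def)
qed

lemma abs_sin_diff_le: "\<bar>sin x - sin y\<bar> \<le> \<bar>x - y\<bar>" for x y :: real
  using abs_sin_x_le_abs_x[of "(x - y)/2"] abs_cos_le_one[of "(x + y)/2"]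
    mult_mono[of "\<bar>sin ((x - y)/2)\<bar>" "\<bar>(x - y)/2\<bar>" "\<bar>cos ((x + y)/2)\<bar>" 1]
  by (simp add: sin_diff_sin abs_mult)

text \<open>The derivative of \<open>sin z - z cos c\<close> is at most \<open>\<epsilon>\<close> in size within distance \<open>\<epsilon>\<close> of \<open>c\<close>.\<close>

lemma sin_diff_linearization:
  fixes x y c :: real
  assumes "\<bar>x - c\<bar> \<le> \<epsilon>" "\<bar>y - c\<bar> \<le> \<epsilon>"
  shows "\<bar>sin y - sin x - cos c * (y - x)\<bar> \<le> \<epsilon> * \<bar>y - x\<bar>"
proof -
  have cosl: "\<bar>cos u - cos v\<bar> \<le> \<bar>u - v\<bar>" for u v :: real
    using abs_sin_x_le_abs_x[of "(v - u)/2"] abs_sin_le_one[of "(u + v)/2"]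
      mult_mono[of "\<bar>sin ((u + v)/2)\<bar>" 1 "\<bar>sin ((v - u)/2)\<bar>" "\<bar>(v - u)/2\<bar>"]
    by (simp add: cos_diff_cos abs_mult)
  have "norm ((sin y - cos c * y) - (sin x - cos c * x)) \<le> \<epsilon> * norm (y - x)"
  proof (rule field_differentiable_bound[of "cball c \<epsilon>" _ "\<lambda>z. cos z - cos c"])
    fix z assume "z \<in> cball c \<epsilon>"
    then show "norm (cos z - cos c) \<le> \<epsilon>"
      using cosl[of z c] by (simp add: dist_real_def abs_minus_commute)
  qed (use assms in \<open>auto intro!: derivative_eq_intros simp: dist_real_def abs_minus_commute\<close>)
  then show ?thesis by (simp add: algebra_simps)
qed

section \<open>Global solutions of Lipschitz differential equations\<close>

text \<open>
  Picard iteration, made a contraction on the whole half-line at once by writing a curve as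
  \<open>x0 + exp (a t) g(t)\<close> with \<open>g\<close> bounded and \<open>a = 2 L\<close>: in terms of \<open>g\<close> the integral operator
  has Lipschitz constant \<open>L / a = 1 / 2\<close>.
\<close>

lemma lipschitz_ode_global_solution:
  fixes F :: "'a::euclidean_space \<Rightarrow> 'a"
  assumes lip: "\<And>x y. norm (F x - F y) \<le> L * norm (x - y)" and L: "L > 0"
    and bnd: "\<And>x. norm (F x) \<le> M"
  shows "\<exists>\<theta>. \<theta> 0 = x0 \<and> (\<forall>t\<ge>0. (\<theta> has_vector_derivative F (\<theta> t)) (at t within {0..}))"
proof -
  define a where "a = 2 * L"
  have a: "a > 0" using L by (simp add: a_def)
  have contF: "continuous_on S F" for S
    by (rule lipschitz_on_continuous_on[of L]) (use lip L in \<open>auto simp: lipschitz_on_def dist_norm\<close>)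
  have M: "M \<ge> 0" using bnd[of 0] norm_ge_zero order_trans by blast
  define curve where "curve g s = x0 + exp (a * s) *\<^sub>R apply_bcontfun g s" for g :: "real \<Rightarrow>\<^sub>C 'a" and s
  have contC: "continuous_on S (\<lambda>s. F (curve g s))" for S g
    unfolding curve_def
    by (rule continuous_on_compose2[OF contF[of UNIV]]) (auto intro!: continuous_intros)
  define I where "I g t = integral {0..t} (\<lambda>s. F (curve g s))" for g t
  (* Bounded continuous functions live on the whole real line, so H g is extended to negative
     times by its value at 0. *)
  define H where "H g t = exp (- a * max 0 t) *\<^sub>R I g (max 0 t)" for g t
  have intF: "(\<lambda>s. F (curve g s)) integrable_on {0..t}" for g t
    by (rule integrable_continuous_real[OF contC])
  have derI: "(I g has_vector_derivative F (curve g t)) (at t within {0..})" if "t \<ge> 0" for g t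
  proof -
    have "(I g has_vector_derivative F (curve g t)) (at t within {0..t+1})"
      unfolding I_def by (rule integral_has_vector_derivative[OF contC]) (use that in auto)
    moreover have "at t within {0..t+1} = at t within {0..}"
      by (rule at_within_nhd[of _ "{..<t+1}"]) (use that in auto)
    ultimately show ?thesis by simp
  qed
  have contI: "continuous_on {0..} (I g)" for g
    using derI by (meson atLeast_iff continuous_on_eq_continuous_within has_vector_derivative_continuous)
  have "H g \<in> bcontfun" for g
  proof (rule bcontfun_normI)
    show "continuous_on UNIV (H g)"
      unfolding H_def by (intro continuous_intros continuous_on_compose2[OF contI]) auto
    fix t :: real
    let ?t = "max 0 t"
    have "norm (I g ?t) \<le> M * (?t - 0)"
      unfolding I_def by (rule integral_bound) (use contC bnd in auto)
    then have "norm (H g t) \<le> exp (- a * ?t) * (M * ?t)"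
      by (simp add: H_def mult_left_mono)
    also have "\<dots> = (M / a) * (a * ?t * exp (- (a * ?t)))" using a by simp
    also have "\<dots> \<le> (M / a) * 1"
    proof (rule mult_left_mono)
      have "a * ?t \<le> exp (a * ?t)" using exp_ge_add_one_self[of "a * ?t"] by linarith
      then show "a * ?t * exp (- (a * ?t)) \<le> 1" by (simp add: exp_minus field_simps)
    qed (use M a in auto)
    finally show "norm (H g t) \<le> M / a" by simp
  qed
  then have app: "apply_bcontfun (Bcontfun (H g)) = H g" for g by (rule Bcontfun_inverse)
  have "dist (Bcontfun (H g)) (Bcontfun (H h)) \<le> (1/2) * dist g h" for g h
  proof (rule dist_bound)
    fix t :: real
    let ?t = "max 0 t"
    have pw: "norm (F (curve g s) - F (curve h s)) \<le> L * dist g h * exp (a * s)" for s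
    proof -
      have "norm (F (curve g s) - F (curve h s)) \<le> L * norm (curve g s - curve h s)" by (rule lip)
      also have "norm (curve g s - curve h s) = exp (a * s) * dist (apply_bcontfun g s) (apply_bcontfun h s)"
        by (simp add: curve_def dist_norm flip: scaleR_diff_right)
      also have "\<dots> \<le> exp (a * s) * dist g h" by (intro mult_left_mono dist_bounded) auto
      finally show ?thesis using L by (simp add: mult_ac mult_left_mono)
    qed
    have ie: "((\<lambda>s. L * dist g h * exp (a * s)) has_integral
        L * dist g h * exp (a * ?t) / a - L * dist g h * exp (a * 0) / a) {0..?t}"
      by (rule fundamental_theorem_of_calculus)
        (use a in \<open>auto intro!: derivative_eq_intros simp flip: has_real_derivative_iff_has_vector_derivative\<close>)
    have "norm (I g ?t - I h ?t) = norm (integral {0..?t} (\<lambda>s. F (curve g s) - F (curve h s)))"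
      unfolding I_def by (simp add: integral_diff intF)
    also have "\<dots> \<le> integral {0..?t} (\<lambda>s. L * dist g h * exp (a * s))"
      by (rule integral_norm_bound_integral)
        (use ie pw in \<open>auto intro: integrable_diff intF has_integral_integrable\<close>)
    also have "\<dots> = L * dist g h * exp (a * ?t) / a - L * dist g h / a"
      using integral_unique[OF ie] by simp
    also have "\<dots> \<le> L * dist g h * exp (a * ?t) / a" using L a by simp
    also have "\<dots> = (1/2) * dist g h * exp (a * ?t)" using L by (simp add: a_def)
    finally have "norm (I g ?t - I h ?t) \<le> (1/2) * dist g h * exp (a * ?t)" .
    then have "exp (- a * ?t) * norm (I g ?t - I h ?t) \<le> exp (- a * ?t) * ((1/2) * dist g h * exp (a * ?t))"
      by (rule mult_left_mono) simp
    also have "\<dots> = (1/2) * dist g h" by (simp add: exp_minus)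
    finally show "dist (Bcontfun (H g) t) (Bcontfun (H h) t) \<le> (1/2) * dist g h"
      by (simp add: app dist_norm H_def flip: scaleR_diff_right)
  qed
  then obtain g where g: "Bcontfun (H g) = g"
    using banach_fix_type[of "1/2" "\<lambda>g. Bcontfun (H g)"] by auto
  have fixpt: "curve g t = x0 + I g t" if "t \<ge> 0" for t
  proof -
    have "apply_bcontfun g t = H g t" using app[of g] by (simp add: g)
    then show ?thesis using that by (simp add: curve_def H_def flip: exp_add)
  qed
  show ?thesis
  proof (intro exI conjI allI impI)
    show "x0 + I g 0 = x0" by (simp add: I_def)
    fix t :: real assume t: "t \<ge> 0"
    show "((\<lambda>t. x0 + I g t) has_vector_derivative F (x0 + I g t)) (at t within {0..})"
      using derI[OF t, of g] fixpt[OF t] by (auto intro!: derivative_eq_intros)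
  qed
qed

section \<open>Null sets from disjoint translates\<close>

text \<open>
  Infinitely many disjoint translates of a bounded piece of \<open>S\<close> fit into one ball, so the piece has
  measure \<open>0\<close>.
\<close>

lemma negligible_if_disjoint_translates:
  fixes S :: "'a::euclidean_space set"
  assumes "closed S" and disj: "\<And>x \<delta>. x \<in> S \<Longrightarrow> 0 < \<delta> \<Longrightarrow> \<delta> < 1 \<Longrightarrow> x + \<delta> *\<^sub>R v \<notin> S"
  shows "negligible S"
proof -
  have fin_cball: "emeasure lebesgue (cball (0::'a) r) \<noteq> top" for r
    using emeasure_lborel_cball_finite[of "0::'a" r] by (simp add: less_top)
  have "negligible (S \<inter> cball 0 (real m))" for m
  proof -
    define T where "T = S \<inter> cball 0 (real m)"
    define \<delta> where "\<delta> n = inverse (real (n + 2))" for n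
    define A where "A n = (+) (\<delta> n *\<^sub>R v) ` T" for n
    have T: "T \<in> sets lebesgue"
      unfolding T_def using assms(1) by (auto simp: borel_closed intro!: sets.Int)
    have A: "A n \<in> sets lebesgue" for n
      unfolding A_def using T by (rule lebesgue_sets_translation)
    have eA: "emeasure lebesgue (A n) = emeasure lebesgue T" for n
      using emeasure_lebesgue_affine[of 1 "\<delta> n *\<^sub>R v" T] by (simp add: A_def add.commute[of "\<delta> n *\<^sub>R v"])
    have \<delta>: "0 < \<delta> n" "\<delta> n < 1" for n
      unfolding \<delta>_def by (auto simp: field_simps)
    have dT: "x + (\<delta> p - \<delta> q) *\<^sub>R v \<notin> T" if "x \<in> T" "p < q" for x p q
    proof -
      have "\<delta> q < \<delta> p" using that(2) by (simp add: \<delta>_def)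
      then show ?thesis using disj[of x "\<delta> p - \<delta> q"] that \<delta>[of p] \<delta>[of q] by (auto simp: T_def)
    qed
    have dis: "A p \<inter> A q = {}" if "p < q" for p q
    proof (rule ccontr)
      assume "A p \<inter> A q \<noteq> {}"
      then obtain x y where xy: "x \<in> T" "y \<in> T" "\<delta> p *\<^sub>R v + x = \<delta> q *\<^sub>R v + y"
        by (auto simp: A_def)
      then have "y = x + (\<delta> p - \<delta> q) *\<^sub>R v" by (simp add: algebra_simps)
      with dT[OF xy(1) that] xy(2) show False by simp
    qed
    have "disjoint_family A"
      unfolding disjoint_family_on_def using dis by (metis Int_commute linorder_neqE_nat)
    then have sm: "(\<Sum>n. emeasure lebesgue (A n)) = emeasure lebesgue (\<Union>n. A n)"
      using A by (intro suminf_emeasure) auto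
    have "(\<Union>n. A n) \<subseteq> cball 0 (real m + norm v)"
    proof clarsimp
      fix x n assume "x \<in> A n"
      then obtain y where y: "norm y \<le> m" "x = \<delta> n *\<^sub>R v + y" by (auto simp: A_def T_def)
      have "norm x \<le> \<delta> n * norm v + norm y"
        using norm_triangle_ineq[of "\<delta> n *\<^sub>R v" y] \<delta>[of n] by (simp add: y)
      also have "\<delta> n * norm v \<le> 1 * norm v" using \<delta>[of n] by (intro mult_right_mono) auto
      finally show "norm x \<le> m + norm v" using y by simp
    qed
    then have "emeasure lebesgue (\<Union>n. A n) \<le> emeasure lebesgue (cball (0::'a) (real m + norm v))"
      by (intro emeasure_mono) auto
    also have "\<dots> < top" using fin_cball by (simp add: less_top)
    finally have fin: "(\<Sum>n. emeasure lebesgue T) < top"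
      using sm by (simp add: eA)
    have "emeasure lebesgue T \<noteq> top"
      using emeasure_mono[of T "cball 0 (real m)" lebesgue] fin_cball[of m] by (auto simp: T_def top_unique)
    then have eT: "emeasure lebesgue T = ennreal (measure lebesgue T)"
      by (rule emeasure_eq_ennreal_measure)
    then have "summable (\<lambda>n::nat. measure lebesgue T)"
      using fin by (intro summable_suminf_not_top) auto
    then have "emeasure lebesgue T = 0" by (simp add: summable_const_iff eT)
    then show ?thesis using T by (simp add: negligible_iff_null_sets null_sets_def T_def)
  qed
  then have "negligible (\<Union>m::nat. S \<inter> cball 0 (real m))"
    by (intro negligible_countable_Union) auto
  moreover have "S \<subseteq> (\<Union>m::nat. S \<inter> cball 0 (real m))"
    by (auto simp: real_arch_simple)
  ultimately show ?thesis by (rule negligible_subset)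
qed

section \<open>The equations on the complete network\<close>

text \<open>
  Since \<open>sin 0 = 0\<close>, the zero diagonal of the adjacency matrix may be replaced by ones, and the
  coupling becomes a sum over all nodes.
\<close>

definition complete_kuramoto :: "real \<Rightarrow> real \<Rightarrow> (real \<Rightarrow> real ^ 'n::finite) \<Rightarrow> bool" where
  "complete_kuramoto a k \<theta> \<longleftrightarrow> (\<forall>t\<ge>0. \<forall>i. ((\<lambda>s. \<theta> s $ i) has_real_derivative
     (a + k * (\<Sum>j\<in>UNIV. sin (\<theta> t $ j - \<theta> t $ i)))) (at t within {0..}))"

lemma kuramoto_solution_complete_homogeneous:
  fixes A :: "real ^ 'n::finite ^ 'n"
  assumes "complete_network A" "homogeneous \<omega>"
  shows "kuramoto_solution \<omega> k A \<theta> \<longleftrightarrow> complete_kuramoto (\<omega> $ i) k \<theta>"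
proof -
  have "(\<Sum>j\<in>UNIV. A $ l $ j * sin (\<theta> t $ j - \<theta> t $ l)) = (\<Sum>j\<in>UNIV. sin (\<theta> t $ j - \<theta> t $ l))" for l t
  proof (rule sum.cong)
    fix j show "A $ l $ j * sin (\<theta> t $ j - \<theta> t $ l) = sin (\<theta> t $ j - \<theta> t $ l)"
      using assms(1) by (cases "j = l") (auto simp: complete_network_def)
  qed simp
  moreover define a where "a = \<omega> $ i"
  moreover have "\<omega> $ l = a" for l using assms(2) by (auto simp: homogeneous_def a_def)
  ultimately show ?thesis by (simp add: kuramoto_solution_def complete_kuramoto_def)
qed

lemma complete_kuramoto_global_solution:
  fixes x :: "real ^ 'n::finite"
  assumes k: "k > 0"
  shows "\<exists>\<theta>. complete_kuramoto a k \<theta> \<and> \<theta> 0 = x"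
proof -
  define F :: "real ^ 'n \<Rightarrow> real ^ 'n" where "F y = (\<chi> i. a + k * (\<Sum>j\<in>UNIV. sin (y $ j - y $ i)))" for y
  let ?n = "real CARD('n)"
  have "norm (F y - F z) \<le> (2 * k * ?n * ?n) * norm (y - z)" for y z
  proof -
    have "\<bar>(F y - F z) $ i\<bar> \<le> k * (?n * (2 * norm (y - z)))" for i
    proof -
      have "\<bar>sin (y $ j - y $ i) - sin (z $ j - z $ i)\<bar> \<le> 2 * norm (y - z)" for j
        using abs_sin_diff_le[of "y $ j - y $ i" "z $ j - z $ i"]
          component_le_norm_cart[of "y - z" j] component_le_norm_cart[of "y - z" i] by simp
      then have "(\<Sum>j\<in>UNIV. \<bar>sin (y $ j - y $ i) - sin (z $ j - z $ i)\<bar>) \<le> ?n * (2 * norm (y - z))"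
        using sum_bounded_above[of UNIV "\<lambda>j. \<bar>sin (y $ j - y $ i) - sin (z $ j - z $ i)\<bar>"] by simp
      then have "\<bar>\<Sum>j\<in>UNIV. sin (y $ j - y $ i) - sin (z $ j - z $ i)\<bar> \<le> ?n * (2 * norm (y - z))"
        by (rule order_trans[OF sum_abs])
      moreover have "(F y - F z) $ i = k * (\<Sum>j\<in>UNIV. sin (y $ j - y $ i) - sin (z $ j - z $ i))"
        by (simp add: F_def sum_subtractf algebra_simps)
      ultimately show ?thesis using k by (simp add: abs_mult)
    qed
    then have "(\<Sum>i\<in>UNIV. \<bar>(F y - F z) $ i\<bar>) \<le> ?n * (k * (?n * (2 * norm (y - z))))"
      using sum_bounded_above[of UNIV "\<lambda>i. \<bar>(F y - F z) $ i\<bar>"] by simp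
    then show ?thesis
      using norm_le_l1_cart[of "F y - F z"] by (simp add: mult_ac)
  qed
  moreover have "norm (F y) \<le> ?n * (\<bar>a\<bar> + k * ?n)" for y
  proof -
    have "\<bar>F y $ i\<bar> \<le> \<bar>a\<bar> + k * ?n" for i
    proof -
      have "\<bar>\<Sum>j\<in>UNIV. sin (y $ j - y $ i)\<bar> \<le> (\<Sum>j\<in>(UNIV::'n set). 1)"
        by (rule order_trans[OF sum_abs sum_mono]) auto
      then have "k * \<bar>\<Sum>j\<in>UNIV. sin (y $ j - y $ i)\<bar> \<le> k * ?n" using k by (intro mult_left_mono) auto
      then show ?thesis
        using abs_triangle_ineq[of a "k * (\<Sum>j\<in>UNIV. sin (y $ j - y $ i))"] k
        unfolding F_def vec_lambda_beta abs_mult by linarith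
    qed
    then have "(\<Sum>i\<in>UNIV. \<bar>F y $ i\<bar>) \<le> ?n * (\<bar>a\<bar> + k * ?n)"
      using sum_bounded_above[of UNIV "\<lambda>i. \<bar>F y $ i\<bar>"] by simp
    then show ?thesis using norm_le_l1_cart[of "F y"] by simp
  qed
  moreover have "2 * k * ?n * ?n > 0" using k by simp
  ultimately obtain \<theta> where \<theta>: "\<theta> 0 = x"
      "\<And>t. t \<ge> 0 \<Longrightarrow> (\<theta> has_vector_derivative F (\<theta> t)) (at t within {0..})"
    using lipschitz_ode_global_solution[of F "2 * k * ?n * ?n"] by metis
  have "complete_kuramoto a k \<theta>"
    unfolding complete_kuramoto_def
  proof (intro allI impI)
    fix t :: real and i assume t: "t \<ge> 0"
    from bounded_linear.has_vector_derivative[OF bounded_linear_vec_nth \<theta>(2)[OF t], of i]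
    show "((\<lambda>s. \<theta> s $ i) has_real_derivative a + k * (\<Sum>j\<in>UNIV. sin (\<theta> t $ j - \<theta> t $ i))) (at t within {0..})"
      by (simp add: F_def has_real_derivative_iff_has_vector_derivative)
  qed
  with \<theta>(1) show ?thesis by blast
qed

lemma complete_kuramoto_shift:
  assumes th: "complete_kuramoto a k \<theta>" and T: "T \<ge> 0"
  shows "complete_kuramoto a k (\<lambda>t. \<theta> (T + t))"
  unfolding complete_kuramoto_def
proof (intro allI impI)
  fix t :: real and i assume t: "t \<ge> 0"
  have "(((\<lambda>s. \<theta> s $ i) \<circ> (\<lambda>s. T + s)) has_real_derivative
      (a + k * (\<Sum>j\<in>UNIV. sin (\<theta> (T + t) $ j - \<theta> (T + t) $ i))) * 1) (at t within {0..})"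
  proof (rule DERIV_image_chain)
    show "((\<lambda>s. \<theta> s $ i) has_real_derivative a + k * (\<Sum>j\<in>UNIV. sin (\<theta> (T + t) $ j - \<theta> (T + t) $ i)))
        (at (T + t) within (+) T ` {0..})"
      by (rule DERIV_subset[of _ _ _ "{0..}"]) (use th T t in \<open>auto simp: complete_kuramoto_def\<close>)
  qed (auto intro!: derivative_eq_intros)
  then show "((\<lambda>s. \<theta> (T + s) $ i) has_real_derivative
      a + k * (\<Sum>j\<in>UNIV. sin (\<theta> (T + t) $ j - \<theta> (T + t) $ i))) (at t within {0..})"
    by (simp add: o_def)
qed

text \<open>The coupling is antisymmetric in the two nodes, so it cancels in the sum of the phases.\<close>

lemma complete_kuramoto_sum:
  assumes th: "complete_kuramoto a k (\<theta> :: real \<Rightarrow> real ^ 'n::finite)" and t: "t \<ge> 0"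
  shows "(\<Sum>i\<in>UNIV. \<theta> t $ i) = (\<Sum>i\<in>UNIV. \<theta> 0 $ i) + real CARD('n) * a * t"
proof -
  have z: "(\<Sum>i\<in>UNIV. \<Sum>j\<in>UNIV. sin (\<theta> s $ j - \<theta> s $ i)) = 0" for s
  proof -
    have "(\<Sum>i\<in>UNIV. \<Sum>j\<in>UNIV. sin (\<theta> s $ j - \<theta> s $ i)) = (\<Sum>i\<in>UNIV. \<Sum>j\<in>UNIV. sin (\<theta> s $ i - \<theta> s $ j))"
      by (rule sum.swap)
    also have "\<dots> = - (\<Sum>i\<in>UNIV. \<Sum>j\<in>UNIV. sin (\<theta> s $ j - \<theta> s $ i))"
      unfolding sum_negf[symmetric] by (intro sum.cong refl) (metis minus_diff_eq sin_minus)
    finally show ?thesis by simp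
  qed
  define f where "f s = (\<Sum>i\<in>UNIV. \<theta> s $ i) - real CARD('n) * a * s" for s
  have der: "(f has_real_derivative 0) (at s within {0..})" if "s \<ge> 0" for s
  proof -
    have "(f has_real_derivative (\<Sum>i\<in>UNIV. a + k * (\<Sum>j\<in>UNIV. sin (\<theta> s $ j - \<theta> s $ i))) - real CARD('n) * a)
        (at s within {0..})"
      unfolding f_def using th that by (auto intro!: derivative_eq_intros simp: complete_kuramoto_def)
    then show ?thesis by (simp add: sum.distrib z flip: sum_distrib_left)
  qed
  then have "((\<lambda>s. - f s) has_real_derivative 0) (at s within {0..})" if "s \<ge> 0" for s
    using that by (auto intro!: derivative_eq_intros)
  from nondecreasing_if_derivative_nonneg[OF this, of 0 t] nondecreasing_if_derivative_nonneg[OF der, of 0 t]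
  have "f t = f 0" using t by simp
  then show ?thesis by (simp add: f_def)
qed

text \<open>
  This bounds what a coupling of size \<open>\<bar>d\<^sub>j - d\<^sub>i\<bar>\<close> between the nodes can contribute to the derivative
  of a quadratic form in \<open>d\<close>: the full coupling in Gronwall's inequality, the linearisation error
  near an antiphase state.
\<close>

lemma sum_abs_mult_diff_le:
  fixes d :: "'n::finite \<Rightarrow> real"
  shows "(\<Sum>i\<in>UNIV. \<Sum>j\<in>UNIV. \<bar>d i\<bar> * \<bar>d j - d i\<bar>) \<le> 2 * real CARD('n) * (\<Sum>i\<in>UNIV. (d i)\<^sup>2)"
proof -
  have "\<bar>d i\<bar> * \<bar>d j - d i\<bar> \<le> (3 * (d i)\<^sup>2 + (d j)\<^sup>2) / 2" for i j
  proof -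
    have "\<bar>d i\<bar> * \<bar>d j - d i\<bar> \<le> \<bar>d i\<bar> * (\<bar>d j\<bar> + \<bar>d i\<bar>)" by (intro mult_left_mono) auto
    also have "\<dots> = \<bar>d i\<bar> * \<bar>d j\<bar> + (d i)\<^sup>2" by (simp add: algebra_simps power2_eq_square abs_mult_self_eq)
    also have "\<bar>d i\<bar> * \<bar>d j\<bar> \<le> ((d i)\<^sup>2 + (d j)\<^sup>2) / 2"
      using sum_squares_bound[of "\<bar>d i\<bar>" "\<bar>d j\<bar>"] by simp
    finally show ?thesis by (simp add: field_simps)
  qed
  then have "(\<Sum>i\<in>UNIV. \<Sum>j\<in>UNIV. \<bar>d i\<bar> * \<bar>d j - d i\<bar>)
      \<le> (\<Sum>i\<in>UNIV. \<Sum>j\<in>UNIV. (3 * (d i)\<^sup>2 + (d j)\<^sup>2) / 2)"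
    by (intro sum_mono)
  also have "\<dots> = 2 * real CARD('n) * (\<Sum>i\<in>UNIV. (d i)\<^sup>2)"
    by (simp add: sum.distrib flip: sum_divide_distrib sum_distrib_left)
  finally show ?thesis .
qed

text \<open>
  The forward bound gives continuous dependence on the initial phases; the backward bound says that
  the time-\<open>t\<close> map has a Lipschitz inverse on its range.
\<close>

lemma complete_kuramoto_dist_bounds:
  fixes \<theta> \<phi> :: "real \<Rightarrow> real ^ 'n::finite"
  assumes k: "k > 0" and th: "complete_kuramoto a k \<theta>" and ph: "complete_kuramoto a k \<phi>" and t: "t \<ge> 0"
  defines "L \<equiv> 2 * k * real CARD('n)"
  shows "norm (\<phi> t - \<theta> t) \<le> exp (L * t) * norm (\<phi> 0 - \<theta> 0)"
    and "norm (\<phi> 0 - \<theta> 0) \<le> exp (L * t) * norm (\<phi> t - \<theta> t)"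
proof -
  define d where "d t i = \<phi> t $ i - \<theta> t $ i" for t i
  define r where "r t i j = sin (\<phi> t $ j - \<phi> t $ i) - sin (\<theta> t $ j - \<theta> t $ i)" for t i j
  define D where "D t = (\<Sum>i\<in>UNIV. (d t i)\<^sup>2)" for t
  define D' where "D' t = (\<Sum>i\<in>UNIV. 2 * d t i * (k * (\<Sum>j\<in>UNIV. r t i j)))" for t
  have D: "D t = (norm (\<phi> t - \<theta> t))\<^sup>2" for t
    by (simp add: D_def d_def norm_vec_def L2_set_def sum_nonneg)
  have "((\<lambda>s. d s i) has_real_derivative k * (\<Sum>j\<in>UNIV. r t i j)) (at t within {0..})" if "t \<ge> 0" for t i
    using th ph that unfolding complete_kuramoto_def d_def r_def
    by (auto intro!: derivative_eq_intros simp: sum_subtractf algebra_simps)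
  then have derD: "(D has_real_derivative D' t) (at t within {0..})" if "t \<ge> 0" for t
    using that unfolding D_def D'_def by (auto intro!: derivative_eq_intros simp: mult_ac)
  have bnd: "\<bar>D' t\<bar> \<le> 2 * L * D t" for t
  proof -
    have r: "\<bar>r t i j\<bar> \<le> \<bar>d t j - d t i\<bar>" for i j
      using abs_sin_diff_le[of "\<phi> t $ j - \<phi> t $ i" "\<theta> t $ j - \<theta> t $ i"]
      by (simp add: r_def d_def algebra_simps)
    have "\<bar>D' t\<bar> \<le> (\<Sum>i\<in>UNIV. \<bar>2 * d t i * (k * (\<Sum>j\<in>UNIV. r t i j))\<bar>)"
      unfolding D'_def by (rule sum_abs)
    also have "\<dots> = (\<Sum>i\<in>UNIV. 2 * k * (\<bar>d t i\<bar> * \<bar>\<Sum>j\<in>UNIV. r t i j\<bar>))"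
      using k by (simp add: abs_mult mult_ac)
    also have "\<dots> = 2 * k * (\<Sum>i\<in>UNIV. \<bar>d t i\<bar> * \<bar>\<Sum>j\<in>UNIV. r t i j\<bar>)"
      by (simp only: sum_distrib_left)
    also have "\<dots> \<le> 2 * k * (\<Sum>i\<in>UNIV. \<bar>d t i\<bar> * (\<Sum>j\<in>UNIV. \<bar>d t j - d t i\<bar>))"
      using k by (intro mult_left_mono sum_mono order_trans[OF sum_abs] r) auto
    also have "\<dots> = 2 * k * (\<Sum>i\<in>UNIV. \<Sum>j\<in>UNIV. \<bar>d t i\<bar> * \<bar>d t j - d t i\<bar>)"
      by (simp add: sum_distrib_left)
    also have "\<dots> \<le> 2 * k * (2 * real CARD('n) * D t)"
      unfolding D_def using k by (intro mult_left_mono sum_abs_mult_diff_le) auto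
    finally show ?thesis by (simp add: L_def mult_ac)
  qed
  note gronwall = gronwall_two_sided[OF derD bnd t]
  from gronwall(1) have "(norm (\<phi> t - \<theta> t))\<^sup>2 \<le> (exp (L * t) * norm (\<phi> 0 - \<theta> 0))\<^sup>2"
    by (simp only: D power_mult_distrib)
  then show "norm (\<phi> t - \<theta> t) \<le> exp (L * t) * norm (\<phi> 0 - \<theta> 0)"
    by (rule power2_le_imp_le) simp
  from gronwall(2) have "(norm (\<phi> 0 - \<theta> 0))\<^sup>2 \<le> (exp (L * t) * norm (\<phi> t - \<theta> t))\<^sup>2"
    by (simp only: D power_mult_distrib)
  then show "norm (\<phi> 0 - \<theta> 0) \<le> exp (L * t) * norm (\<phi> t - \<theta> t)"
    by (rule power2_le_imp_le) simp
qed

section \<open>Repulsion from antiphase states\<close>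

text \<open>
  Only phase differences are compared with \<open>c\<close>, because the phases themselves rotate. They are not
  reduced modulo \<open>2\<pi>\<close>: \<open>c\<close> also fixes the lift, so that the differences of two such solutions are
  small real numbers.
\<close>

definition stays_near :: "real \<Rightarrow> ('n \<Rightarrow> real) \<Rightarrow> (real \<Rightarrow> real ^ 'n::finite) \<Rightarrow> bool" where
  "stays_near \<epsilon> c \<theta> \<longleftrightarrow> (\<forall>t\<ge>0. \<forall>i j. \<bar>\<theta> t $ j - \<theta> t $ i - (c j - c i)\<bar> \<le> \<epsilon>)"

text \<open>
  With signs \<open>s\<^sub>i = cos c\<^sub>i\<close> and \<open>\<sigma> = \<Sum>\<^sub>i s\<^sub>i\<close>, the linearised equation for a difference \<open>d\<close> of mean
  \<open>0\<close> is \<open>d\<^sub>i' = k \<Sum>\<^sub>j s\<^sub>i s\<^sub>j (d\<^sub>j - d\<^sub>i)\<close>, and it gives \<open>E' = 2 k \<sigma> \<Sum>\<^sub>i d\<^sub>i\<^sup>2\<close> for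
  \<open>E = - \<Sum>\<^sub>i s\<^sub>i d\<^sub>i\<^sup>2\<close>. The radius \<open>1 / (4 n)\<close> makes the nonlinear error at most half of this, as
  \<open>\<sigma> \<ge> 1\<close>. Moving one minority phase \<open>l\<close> makes \<open>E\<close> positive at time \<open>0\<close>.
\<close>

lemma saddle_repulsion:
  fixes \<theta> \<phi> :: "real \<Rightarrow> real ^ 'n::finite"
  assumes k: "k > 0" and th: "complete_kuramoto a k \<theta>" and ph: "complete_kuramoto a k \<phi>"
    and near: "stays_near (1 / (4 * real CARD('n))) c \<theta>" "stays_near (1 / (4 * real CARD('n))) c \<phi>"
    and c: "\<And>i. sin (c i) = 0" and majority: "(\<Sum>i\<in>UNIV. cos (c i)) > 0" and l: "cos (c l) = -1"
    and start: "\<phi> 0 = \<theta> 0 + \<delta> *\<^sub>R axis l 1"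
  shows "\<delta> = 0"
proof (rule ccontr)
  assume \<delta>: "\<delta> \<noteq> 0"
  define n where "n = real CARD('n)"
  have n: "n \<ge> 1" by (simp add: n_def Suc_leI)
  define s where "s i = cos (c i)" for i
  define \<sigma> where "\<sigma> = (\<Sum>i\<in>UNIV. s i)"
  (* The difference is taken modulo its mean, which stays delta / n because the sum of the phases
     moves at the same rate for both solutions. *)
  define d where "d t i = \<phi> t $ i - \<theta> t $ i - \<delta> / n" for t i
  define r where "r t i j = sin (\<phi> t $ j - \<phi> t $ i) - sin (\<theta> t $ j - \<theta> t $ i)" for t i j
  (* Linearising at c turns the coupling difference r into s i * s j * (d j - d i); q is the error. *)
  define q where "q t i j = r t i j - s i * s j * (d t j - d t i)" for t i j
  define N where "N t = (\<Sum>i\<in>UNIV. (d t i)\<^sup>2)" for t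
  define E where "E t = - (\<Sum>i\<in>UNIV. s i * (d t i)\<^sup>2)" for t
  define E' where "E' t = - (\<Sum>i\<in>UNIV. s i * (2 * d t i * (k * (\<Sum>j\<in>UNIV. r t i j))))" for t
  have s1: "s i = 1 \<or> s i = -1" for i
    using sin_zero_abs_cos_one[OF c[of i]] by (auto simp: s_def)
  have ss: "s i * s i = 1" for i using s1[of i] by auto
  have sabs: "\<bar>s i\<bar> = 1" for i using s1[of i] by auto
  have sl: "s l = -1" by (simp add: s_def l)
  (* The majority exceeds the minority by an integer, so sigma is bounded away from 0. *)
  have "\<sigma> \<in> \<int>" unfolding \<sigma>_def using s1 by (intro Ints_sum) (metis Ints_1 Ints_minus)
  moreover have "\<sigma> > 0" using majority by (simp add: \<sigma>_def s_def)
  ultimately have \<sigma>1: "\<sigma> \<ge> 1" by (auto elim!: Ints_cases)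
  have \<sigma>n: "\<sigma> \<le> n - 2"
  proof -
    have "(\<Sum>i\<in>UNIV - {l}. s i) \<le> (\<Sum>i\<in>UNIV - {l}. 1)" using s1 by (intro sum_mono) (metis le_minus_one_simps(1) order.refl order_trans zero_le_one)
    also have "\<dots> = n - 1" by (simp add: n_def card_Diff_singleton of_nat_diff Suc_leI)
    finally show ?thesis by (simp add: \<sigma>_def sl sum.remove[of UNIV l s])
  qed
  have sumd: "(\<Sum>i\<in>UNIV. d t i) = 0" if "t \<ge> 0" for t
    using complete_kuramoto_sum[OF th that] complete_kuramoto_sum[OF ph that] n
    by (simp add: d_def sum_subtractf start sum.distrib axis_def n_def flip: sum_distrib_left)
  have "((\<lambda>s. d s i) has_real_derivative k * (\<Sum>j\<in>UNIV. r t i j)) (at t within {0..})" if "t \<ge> 0" for t i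
    using th ph that unfolding complete_kuramoto_def d_def r_def
    by (auto intro!: derivative_eq_intros simp: sum_subtractf algebra_simps)
  then have derE: "(E has_real_derivative E' t) (at t within {0..})" if "t \<ge> 0" for t
    using that unfolding E_def E'_def by (auto intro!: derivative_eq_intros simp: mult_ac)
  have q: "\<bar>q t i j\<bar> \<le> 1 / (4 * n) * \<bar>d t j - d t i\<bar>" if "t \<ge> 0" for t i j
  proof -
    have "cos (c j - c i) = s i * s j" by (simp add: cos_diff c s_def)
    with sin_diff_linearization[of "\<theta> t $ j - \<theta> t $ i" "c j - c i" "1 / (4 * n)" "\<phi> t $ j - \<phi> t $ i"]
    show ?thesis using near that by (simp add: stays_near_def q_def r_def d_def n_def algebra_simps)
  qed
  have growth: "k * N t \<le> E' t" if t: "t \<ge> 0" for t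
  proof -
    have "(\<Sum>i\<in>UNIV. s i * d t i * (\<Sum>j\<in>UNIV. s i * s j * (d t j - d t i)))
        = (\<Sum>i\<in>UNIV. \<Sum>j\<in>UNIV. d t i * (s j * d t j) - s j * (d t i)\<^sup>2)"
      unfolding sum_distrib_left
    proof (intro sum.cong refl)
      fix i j
      have "s i * d t i * (s i * s j * (d t j - d t i)) = (s i * s i) * (s j * d t i * (d t j - d t i))"
        by (simp add: algebra_simps)
      then show "s i * d t i * (s i * s j * (d t j - d t i)) = d t i * (s j * d t j) - s j * (d t i)\<^sup>2"
        by (simp add: ss algebra_simps power2_eq_square)
    qed
    (* The rank-one part of the linearisation drops out because d has mean 0. *)
    also have "\<dots> = (\<Sum>i\<in>UNIV. d t i) * (\<Sum>j\<in>UNIV. s j * d t j) - \<sigma> * N t"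
      by (simp add: sum_subtractf sum_product \<sigma>_def N_def sum.swap[of "\<lambda>i j. s j * (d t i)\<^sup>2"])
    finally have main: "(\<Sum>i\<in>UNIV. s i * d t i * (\<Sum>j\<in>UNIV. s i * s j * (d t j - d t i))) = - \<sigma> * N t"
      by (simp add: sumd[OF t])
    have "\<bar>\<Sum>i\<in>UNIV. s i * d t i * (\<Sum>j\<in>UNIV. q t i j)\<bar> \<le> (\<Sum>i\<in>UNIV. \<bar>d t i\<bar> * (\<Sum>j\<in>UNIV. 1 / (4 * n) * \<bar>d t j - d t i\<bar>))"
      by (rule order_trans[OF sum_abs])
        (auto simp: abs_mult sabs intro!: sum_mono mult_left_mono order_trans[OF sum_abs] q[OF t, simplified])
    also have "\<dots> = 1 / (4 * n) * (\<Sum>i\<in>UNIV. \<Sum>j\<in>UNIV. \<bar>d t i\<bar> * \<bar>d t j - d t i\<bar>)"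
      by (simp add: sum_distrib_left mult_ac)
    also have "\<dots> \<le> 1 / (4 * n) * (2 * n * N t)"
      unfolding N_def n_def by (intro mult_left_mono sum_abs_mult_diff_le) auto
    also have "\<dots> = N t / 2" using n by simp
    finally have err: "\<bar>\<Sum>i\<in>UNIV. s i * d t i * (\<Sum>j\<in>UNIV. q t i j)\<bar> \<le> N t / 2" .
    have "E' t = - 2 * k * (\<Sum>i\<in>UNIV. s i * d t i * (\<Sum>j\<in>UNIV. r t i j))"
      by (simp add: E'_def sum_distrib_left sum_negf mult_ac)
    also have "(\<Sum>i\<in>UNIV. s i * d t i * (\<Sum>j\<in>UNIV. r t i j)) =
       (\<Sum>i\<in>UNIV. s i * d t i * (\<Sum>j\<in>UNIV. s i * s j * (d t j - d t i))) + (\<Sum>i\<in>UNIV. s i * d t i * (\<Sum>j\<in>UNIV. q t i j))"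
      by (simp add: q_def sum_subtractf sum.distrib ring_distribs)
    also note main
    finally have "E' t = 2 * k * (\<sigma> * N t - (\<Sum>i\<in>UNIV. s i * d t i * (\<Sum>j\<in>UNIV. q t i j)))"
      by (simp add: right_diff_distrib distrib_left)
    moreover have "N t / 2 \<le> \<sigma> * N t - (\<Sum>i\<in>UNIV. s i * d t i * (\<Sum>j\<in>UNIV. q t i j))"
    proof -
      have "N t \<ge> 0" by (simp add: N_def sum_nonneg)
      then have "1 * N t \<le> \<sigma> * N t" using \<sigma>1 by (intro mult_right_mono)
      then show ?thesis using err by linarith
    qed
    then have "2 * k * (N t / 2) \<le> 2 * k * (\<sigma> * N t - (\<Sum>i\<in>UNIV. s i * d t i * (\<Sum>j\<in>UNIV. q t i j)))"
      using k by (intro mult_left_mono) auto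
    ultimately show ?thesis by simp
  qed
  have EN: "E t \<le> N t" for t
    unfolding E_def N_def sum_negf[symmetric]
  proof (intro sum_mono)
    fix i show "- (s i * (d t i)\<^sup>2) \<le> (d t i)\<^sup>2" using s1[of i] by auto
  qed
  have N0: "N t \<ge> 0" for t by (simp add: N_def sum_nonneg)
  have E0: "E 0 > 0"
  proof -
    have d0: "d 0 i = \<delta> * ((if i = l then 1 else 0) - 1 / n)" for i
      by (simp add: d_def start axis_def algebra_simps)
    have "(\<Sum>i\<in>UNIV. s i * (d 0 i)\<^sup>2) = (\<Sum>i\<in>UNIV. \<delta>\<^sup>2 * (s i * (1 / n)\<^sup>2 + (if i = l then s i * (1 - 2 / n) else 0)))"
      by (intro sum.cong refl) (auto simp: d0 power2_eq_square algebra_simps)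
    also have "\<dots> = \<delta>\<^sup>2 * (\<sigma> * (1 / n)\<^sup>2 + s l * (1 - 2 / n))"
      by (simp add: sum.distrib \<sigma>_def flip: sum_distrib_left sum_distrib_right sum_divide_distrib)
    finally have "E 0 = \<delta>\<^sup>2 * (1 - 2 / n - \<sigma> / n\<^sup>2)" by (simp add: E_def sl power2_eq_square algebra_simps)
    also have "1 - 2 / n - \<sigma> / n\<^sup>2 = (n * n - 2 * n - \<sigma>) / n\<^sup>2" using n by (simp add: field_simps power2_eq_square)
    finally have E: "E 0 = \<delta>\<^sup>2 * ((n * n - 2 * n - \<sigma>) / n\<^sup>2)" .
    (* A nonempty minority forces n \<ge> 3, since 1 \<le> sigma \<le> n - 2. *)
    have "(n - 1) * (n - 2) > 0" using \<sigma>1 \<sigma>n by (intro mult_pos_pos) auto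
    then have "n * n - 2 * n - \<sigma> > 0" using \<sigma>n by (simp add: algebra_simps)
    then show ?thesis using \<delta> n by (simp add: E)
  qed
  have mono: "E 0 \<le> E t" if "t \<ge> 0" for t
  proof (rule nondecreasing_if_derivative_nonneg[OF derE])
    fix t :: real assume "t \<ge> 0"
    then have "k * N t \<le> E' t" by (rule growth)
    moreover have "0 \<le> k * N t" using k N0 by simp
    ultimately show "0 \<le> E' t" by linarith
  qed (use that in auto)
  have lin: "E 0 + k * E 0 * t \<le> E t" if "t \<ge> 0" for t
  proof -
    have "E 0 - k * E 0 * 0 \<le> E t - k * E 0 * t"
    proof (rule nondecreasing_if_derivative_nonneg[where f = "\<lambda>t. E t - k * E 0 * t"
          and f' = "\<lambda>t. E' t - k * E 0"])
      fix t :: real assume t: "t \<ge> 0"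
      have "k * E 0 \<le> k * N t" using k mono[OF t] EN[of t] by (intro mult_left_mono) auto
      then show "E' t - k * E 0 \<ge> 0" using growth[OF t] by simp
      show "((\<lambda>t. E t - k * E 0 * t) has_real_derivative E' t - k * E 0) (at t within {0..})"
        using derE[OF t] by (auto intro!: derivative_eq_intros)
    qed (use that in auto)
    then show ?thesis by simp
  qed
  have bdd: "N t \<le> n" if t: "t \<ge> 0" for t
  proof -
    have "(d t i)\<^sup>2 \<le> 1" for i
    proof -
      have sm: "\<bar>d t i - d t j\<bar> \<le> 1 / (4 * n) + 1 / (4 * n)" for j
      proof -
        have "\<bar>\<theta> t $ i - \<theta> t $ j - (c i - c j)\<bar> \<le> 1 / (4 * n)" "\<bar>\<phi> t $ i - \<phi> t $ j - (c i - c j)\<bar> \<le> 1 / (4 * n)"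
          using near t by (auto simp: stays_near_def n_def)
        then show ?thesis unfolding d_def by linarith
      qed
      have dj: "\<bar>d t i - d t j\<bar> \<le> 1" for j
      proof -
        have "1 / (4 * n) \<le> 1 / 2" using n by (simp add: field_simps)
        with sm[of j] show ?thesis by linarith
      qed
      have "n * d t i = (\<Sum>j\<in>UNIV. d t i - d t j)" by (simp add: sum_subtractf sumd[OF t] n_def)
      also have "\<bar>\<dots>\<bar> \<le> (\<Sum>j\<in>(UNIV::'n set). 1)" by (rule order_trans[OF sum_abs sum_mono]) (rule dj)
      finally have "\<bar>n * d t i\<bar> \<le> n * 1" by (simp add: n_def)
      then have "\<bar>d t i\<bar> \<le> 1" using n by (simp add: abs_mult)
      then show ?thesis by (simp add: abs_square_le_1)
    qed
    then have "N t \<le> (\<Sum>i\<in>(UNIV::'n set). 1)" unfolding N_def by (intro sum_mono)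
    then show ?thesis by (simp add: n_def)
  qed
  (* At time n / (k * E 0) the linear lower bound exceeds the upper bound n. *)
  have "E 0 + k * E 0 * (n / (k * E 0)) \<le> n"
    using lin[of "n / (k * E 0)"] EN[of "n / (k * E 0)"] bdd[of "n / (k * E 0)"] k E0 n by simp
  then show False using k E0 by simp
qed

definition captured :: "real \<Rightarrow> real \<Rightarrow> ('n \<Rightarrow> real) \<Rightarrow> (real ^ 'n::finite) set" where
  "captured a k c = {\<theta> 0 | \<theta>. complete_kuramoto a k \<theta> \<and> stays_near (1 / (4 * real CARD('n))) c \<theta>}"

text \<open>Staying near is a closed condition, and solutions depend continuously on their initial phases.\<close>

lemma closed_captured:
  fixes c :: "'n::finite \<Rightarrow> real"
  assumes k: "k > 0"
  shows "closed (captured a k c)"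
  unfolding closed_sequential_limits
proof (intro allI impI)
  fix x :: "nat \<Rightarrow> real ^ 'n" and l
  assume "(\<forall>n. x n \<in> captured a k c) \<and> x \<longlonglongrightarrow> l"
  then have xl: "x \<longlonglongrightarrow> l" and "\<forall>n. \<exists>\<theta>. x n = \<theta> 0 \<and> complete_kuramoto a k \<theta> \<and> stays_near (1 / (4 * real CARD('n))) c \<theta>"
    by (auto simp: captured_def)
  then obtain \<Theta> where \<Theta>: "\<And>n. x n = \<Theta> n 0" "\<And>n. complete_kuramoto a k (\<Theta> n)"
      "\<And>n. stays_near (1 / (4 * real CARD('n))) c (\<Theta> n)" by metis
  obtain \<theta> where \<theta>: "complete_kuramoto a k \<theta>" "\<theta> 0 = l"
    using complete_kuramoto_global_solution[OF k] by blast
  have conv: "(\<lambda>n. \<Theta> n t) \<longlonglongrightarrow> \<theta> t" if t: "t \<ge> 0" for t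
  proof -
    have "(\<lambda>n. exp (2 * k * real CARD('n) * t) * norm (x n - l)) \<longlonglongrightarrow> exp (2 * k * real CARD('n) * t) * 0"
      using xl by (intro tendsto_intros tendsto_norm_zero) (simp add: LIM_zero)
    then have "(\<lambda>n. exp (2 * k * real CARD('n) * t) * norm (x n - l)) \<longlonglongrightarrow> 0" by simp
    then have "(\<lambda>n. \<Theta> n t - \<theta> t) \<longlonglongrightarrow> 0"
    proof (rule Lim_null_comparison[rotated], intro always_eventually allI)
      fix n show "norm (\<Theta> n t - \<theta> t) \<le> exp (2 * k * real CARD('n) * t) * norm (x n - l)"
        using complete_kuramoto_dist_bounds(1)[OF k \<theta>(1) \<Theta>(2)[of n] t] by (simp add: \<Theta>(1) \<theta>(2))
    qed
    then show ?thesis by (rule LIM_zero_cancel)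
  qed
  have "stays_near (1 / (4 * real CARD('n))) c \<theta>"
    unfolding stays_near_def
  proof (intro allI impI)
    fix t :: real and i j assume t: "t \<ge> 0"
    have "(\<lambda>n. \<bar>\<Theta> n t $ j - \<Theta> n t $ i - (c j - c i)\<bar>) \<longlonglongrightarrow> \<bar>\<theta> t $ j - \<theta> t $ i - (c j - c i)\<bar>"
      by (intro tendsto_intros conv[OF t])
    then show "\<bar>\<theta> t $ j - \<theta> t $ i - (c j - c i)\<bar> \<le> 1 / (4 * real CARD('n))"
      by (rule LIMSEQ_le_const2) (use \<Theta>(3) t in \<open>auto simp: stays_near_def\<close>)
  qed
  then show "l \<in> captured a k c" using \<theta> by (auto simp: captured_def)
qed

lemma negligible_captured:
  fixes c :: "'n::finite \<Rightarrow> real"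
  assumes k: "k > 0" and c: "\<And>i. sin (c i) = 0" "(\<Sum>i\<in>UNIV. cos (c i)) > 0" "cos (c l) = -1"
  shows "negligible (captured a k c)"
proof (rule negligible_if_disjoint_translates[OF closed_captured[OF k], where v = "axis l 1"])
  fix x \<delta> assume x: "x \<in> captured a k c" and \<delta>: "0 < (\<delta>::real)"
  show "x + \<delta> *\<^sub>R axis l 1 \<notin> captured a k c"
  proof
    assume "x + \<delta> *\<^sub>R axis l 1 \<in> captured a k c"
    with x obtain \<theta> \<phi> where "complete_kuramoto a k \<theta>" "complete_kuramoto a k \<phi>"
      "stays_near (1 / (4 * real CARD('n))) c \<theta>" "stays_near (1 / (4 * real CARD('n))) c \<phi>"
      "\<phi> 0 = \<theta> 0 + \<delta> *\<^sub>R axis l 1"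
      unfolding captured_def by (smt (verit) mem_Collect_eq)
    from saddle_repulsion[OF k this(1-4) c this(5)] \<delta> show False by simp
  qed
qed

text \<open>The time-\<open>t\<close> map is injective with Lipschitz inverse, and Lipschitz maps preserve null sets.\<close>

lemma negligible_initial_phases:
  fixes S :: "(real ^ 'n::finite) set"
  assumes k: "k > 0" and t: "t \<ge> 0" and neg: "negligible S"
  shows "negligible {\<theta> 0 | \<theta>. complete_kuramoto a k \<theta> \<and> \<theta> t \<in> S}"
proof -
  let ?L = "exp (2 * k * real CARD('n) * t)"
  define R where "R = {(\<theta> t, \<theta> 0) | \<theta> :: real \<Rightarrow> real ^ 'n. complete_kuramoto a k \<theta>}"
  have R: "norm (y0 - x0) \<le> ?L * norm (y - x)" if "(x, x0) \<in> R" "(y, y0) \<in> R" for x x0 y y0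
    using that complete_kuramoto_dist_bounds(2)[OF k _ _ t] by (auto simp: R_def)
  define g where "g y = (SOME x. (y, x) \<in> R)" for y
  have g: "(y, g y) \<in> R" if "(y, x) \<in> R" for x y
    unfolding g_def using that by (rule someI)
  have gu: "g y = x" if "(y, x) \<in> R" for x y
    using R[OF that g[OF that]] by simp
  let ?S = "S \<inter> Domain R"
  have "negligible (g ` ?S)"
  proof (rule negligible_locally_Lipschitz_image)
    show "negligible ?S" using neg by (rule negligible_subset) auto
    fix x assume x: "x \<in> ?S"
    show "\<exists>T B. open T \<and> x \<in> T \<and> (\<forall>y\<in>?S \<inter> T. norm (g y - g x) \<le> B * norm (y - x))"
      by (rule exI[of _ UNIV], rule exI[of _ ?L]) (use x R g in blast)
  qed simp
  moreover have "{\<theta> 0 | \<theta>. complete_kuramoto a k \<theta> \<and> \<theta> t \<in> S} \<subseteq> g ` ?S"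
  proof clarify
    fix \<theta> assume th: "complete_kuramoto a k \<theta>" "\<theta> t \<in> S"
    then have "(\<theta> t, \<theta> 0) \<in> R" by (auto simp: R_def)
    then show "\<theta> 0 \<in> g ` ?S" using gu th(2) by (metis DomainI IntI image_eqI)
  qed
  ultimately show ?thesis by (rule negligible_subset)
qed

section \<open>The order parameter as a Lyapunov function\<close>

text \<open>
  \<open>coherence\<close> is \<open>\<bar>Z\<bar>\<^sup>2\<close> and \<open>torque x i\<close> is \<open>Im (Z exp (- i x\<^sub>i))\<close> for the total phasor
  \<open>Z = \<Sum>\<^sub>j exp (i x\<^sub>j)\<close>.
\<close>

definition coherence :: "real ^ 'n::finite \<Rightarrow> real" where
  "coherence x = (\<Sum>j\<in>UNIV. cos (x $ j))\<^sup>2 + (\<Sum>j\<in>UNIV. sin (x $ j))\<^sup>2"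

definition torque :: "real ^ 'n::finite \<Rightarrow> 'n \<Rightarrow> real" where
  "torque x i = (\<Sum>j\<in>UNIV. sin (x $ j - x $ i))"

lemma torque_eq:
  "torque x i = (\<Sum>j\<in>UNIV. sin (x $ j)) * cos (x $ i) - (\<Sum>j\<in>UNIV. cos (x $ j)) * sin (x $ i)"
  by (simp add: torque_def sin_diff sum_subtractf sum_distrib_right)

lemma torque_bound: "\<bar>torque (x :: real ^ 'n::finite) i\<bar> \<le> real CARD('n)"
proof -
  have "\<bar>torque x i\<bar> \<le> (\<Sum>j\<in>(UNIV::'n set). 1)"
    unfolding torque_def by (rule order_trans[OF sum_abs sum_mono]) auto
  then show ?thesis by simp
qed

lemma coherence_bound: "coherence (x :: real ^ 'n::finite) \<le> 2 * (real CARD('n))\<^sup>2"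
proof -
  have "\<bar>\<Sum>j\<in>UNIV. cos (x $ j)\<bar> \<le> (\<Sum>j\<in>(UNIV::'n set). 1)" "\<bar>\<Sum>j\<in>UNIV. sin (x $ j)\<bar> \<le> (\<Sum>j\<in>(UNIV::'n set). 1)"
    by (rule order_trans[OF sum_abs sum_mono]; simp)+
  then have "(\<Sum>j\<in>UNIV. cos (x $ j))\<^sup>2 \<le> (real CARD('n))\<^sup>2" "(\<Sum>j\<in>UNIV. sin (x $ j))\<^sup>2 \<le> (real CARD('n))\<^sup>2"
    by (simp_all add: abs_le_square_iff[symmetric])
  then show ?thesis by (simp add: coherence_def)
qed

text \<open>
  If \<open>w\<^sub>i = Z exp (- i x\<^sub>i)\<close>, then the imaginary part of \<open>w\<^sub>i\<close> times the conjugate of \<open>w\<^sub>j\<close> is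
  \<open>\<bar>Z\<bar>\<^sup>2 sin (x\<^sub>j - x\<^sub>i)\<close>. So two phases on which little torque acts are nearly parallel or
  antiparallel, provided that \<open>Z\<close> is not small.
\<close>

lemma sin_diff_coherence:
  fixes x :: "real ^ 'n::finite"
  shows "coherence x * \<bar>sin (x $ j - x $ i)\<bar> \<le> 2 * real CARD('n) * (\<bar>torque x i\<bar> + \<bar>torque x j\<bar>)"
proof -
  let ?C = "\<Sum>j\<in>UNIV. cos (x $ j)" and ?S = "\<Sum>j\<in>UNIV. sin (x $ j)"
  (* p i is the real part of Z exp (- i x_i), as torque x i is its imaginary part. *)
  define p where "p i = ?C * cos (x $ i) + ?S * sin (x $ i)" for i
  have p: "\<bar>p l\<bar> \<le> 2 * real CARD('n)" for l
  proof -
    have "\<bar>p l\<bar> = \<bar>\<Sum>j\<in>UNIV. cos (x $ j - x $ l)\<bar>"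
      by (simp add: p_def cos_diff sum.distrib sum_distrib_right)
    also have "\<dots> \<le> (\<Sum>j\<in>(UNIV::'n set). 1)" by (rule order_trans[OF sum_abs sum_mono]) auto
    finally show ?thesis by simp
  qed
  have "coherence x * sin (x $ j - x $ i) = torque x i * p j - p i * torque x j"
    by (simp add: coherence_def torque_eq p_def sin_diff algebra_simps power2_eq_square)
  then have "coherence x * \<bar>sin (x $ j - x $ i)\<bar> = \<bar>torque x i * p j - p i * torque x j\<bar>"
    by (metis abs_mult abs_of_nonneg coherence_def sum_power2_ge_zero)
  also have "\<dots> \<le> \<bar>torque x i\<bar> * \<bar>p j\<bar> + \<bar>p i\<bar> * \<bar>torque x j\<bar>"
    by (metis abs_mult abs_triangle_ineq4)
  also have "\<dots> \<le> \<bar>torque x i\<bar> * (2 * real CARD('n)) + (2 * real CARD('n)) * \<bar>torque x j\<bar>"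
    by (intro add_mono mult_mono p) auto
  finally show ?thesis by (simp add: algebra_simps)
qed

context
  fixes a k :: real and \<theta> :: "real \<Rightarrow> real ^ 'n::finite"
  assumes k: "k > 0" and th: "complete_kuramoto a k \<theta>"
begin

lemma phase_derivative:
  "t \<ge> 0 \<Longrightarrow> ((\<lambda>s. \<theta> s $ i) has_real_derivative a + k * torque (\<theta> t) i) (at t within {0..})"
  using th by (simp add: complete_kuramoto_def torque_def)

lemma coherence_derivative:
  assumes t: "t \<ge> 0"
  shows "((\<lambda>s. coherence (\<theta> s)) has_real_derivative 2 * k * (\<Sum>i\<in>UNIV. (torque (\<theta> t) i)\<^sup>2)) (at t within {0..})"
proof -
  let ?C = "\<Sum>j\<in>UNIV. cos (\<theta> t $ j)" and ?S = "\<Sum>j\<in>UNIV. sin (\<theta> t $ j)" and ?q = "torque (\<theta> t)"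
  have "((\<lambda>s. coherence (\<theta> s)) has_real_derivative
      2 * ?C * (\<Sum>j\<in>UNIV. - sin (\<theta> t $ j) * (a + k * ?q j)) + 2 * ?S * (\<Sum>j\<in>UNIV. cos (\<theta> t $ j) * (a + k * ?q j)))
      (at t within {0..})"
    unfolding coherence_def
    by (auto intro!: derivative_eq_intros phase_derivative[OF t] simp: mult_ac)
  also have "(\<Sum>j\<in>UNIV. - sin (\<theta> t $ j) * (a + k * ?q j)) = - a * ?S - k * (\<Sum>j\<in>UNIV. sin (\<theta> t $ j) * ?q j)"
    by (simp add: ring_distribs sum_subtractf sum_negf sum.distrib sum_distrib_left mult_ac)
  also have "(\<Sum>j\<in>UNIV. cos (\<theta> t $ j) * (a + k * ?q j)) = a * ?C + k * (\<Sum>j\<in>UNIV. cos (\<theta> t $ j) * ?q j)"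
    by (simp add: ring_distribs sum.distrib sum_distrib_left mult_ac)
  also have "2 * ?C * (- a * ?S - k * (\<Sum>j\<in>UNIV. sin (\<theta> t $ j) * ?q j)) + 2 * ?S * (a * ?C + k * (\<Sum>j\<in>UNIV. cos (\<theta> t $ j) * ?q j))
      = 2 * k * (?S * (\<Sum>j\<in>UNIV. cos (\<theta> t $ j) * ?q j) - ?C * (\<Sum>j\<in>UNIV. sin (\<theta> t $ j) * ?q j))"
    by (simp add: algebra_simps)
  also have "?S * (\<Sum>j\<in>UNIV. cos (\<theta> t $ j) * ?q j) - ?C * (\<Sum>j\<in>UNIV. sin (\<theta> t $ j) * ?q j)
      = (\<Sum>j\<in>UNIV. (?S * cos (\<theta> t $ j) - ?C * sin (\<theta> t $ j)) * ?q j)"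
    by (simp add: left_diff_distrib sum_subtractf mult.assoc flip: sum_distrib_left)
  also have "\<dots> = (\<Sum>j\<in>UNIV. (?q j)\<^sup>2)"
    by (simp add: power2_eq_square flip: torque_eq)
  finally show ?thesis .
qed

lemma coherence_mono: "t \<ge> 0 \<Longrightarrow> coherence (\<theta> 0) \<le> coherence (\<theta> t)"
  by (rule nondecreasing_if_derivative_nonneg[OF coherence_derivative])
    (use k in \<open>auto intro!: mult_nonneg_nonneg sum_nonneg\<close>)

text \<open>
  The torques are Lipschitz in time, so Barbalat's lemma applies to the derivative of the bounded
  function \<open>coherence\<close>.
\<close>

lemma torque_tendsto_zero: "((\<lambda>t. torque (\<theta> t) i) \<longlongrightarrow> 0) at_top"
proof -
  define n where "n = real CARD('n)"
  define g where "g t = 2 * k * (\<Sum>i\<in>UNIV. (torque (\<theta> t) i)\<^sup>2)" for t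
  define q' where "q' t i = (\<Sum>j\<in>UNIV. cos (\<theta> t $ j - \<theta> t $ i) * (k * torque (\<theta> t) j - k * torque (\<theta> t) i))" for t i
  have q': "((\<lambda>s. torque (\<theta> s) i) has_real_derivative q' t i) (at t within {0..})" if "t \<ge> 0" for t i
  proof -
    have "(\<lambda>s. torque (\<theta> s) i) = (\<lambda>s. \<Sum>j\<in>UNIV. sin (\<theta> s $ j - \<theta> s $ i))"
      by (simp add: torque_def)
    then show ?thesis
      unfolding q'_def by (auto intro!: derivative_eq_intros phase_derivative[OF that])
  qed
  have q'b: "\<bar>q' t i\<bar> \<le> n * (2 * k * n)" for t i
  proof -
    have "\<bar>cos (\<theta> t $ j - \<theta> t $ i) * (k * torque (\<theta> t) j - k * torque (\<theta> t) i)\<bar> \<le> 2 * k * n" for j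
    proof -
      have "\<bar>cos (\<theta> t $ j - \<theta> t $ i) * (k * torque (\<theta> t) j - k * torque (\<theta> t) i)\<bar>
          \<le> 1 * \<bar>k * (torque (\<theta> t) j - torque (\<theta> t) i)\<bar>"
        unfolding abs_mult right_diff_distrib[symmetric] by (intro mult_right_mono) auto
      also have "\<dots> = k * \<bar>torque (\<theta> t) j - torque (\<theta> t) i\<bar>" using k by (simp add: abs_mult)
      also have "\<dots> \<le> k * (2 * n)"
        using torque_bound[of "\<theta> t" i] torque_bound[of "\<theta> t" j] k by (intro mult_left_mono) (auto simp: n_def)
      finally show ?thesis by simp
    qed
    then show ?thesis
      unfolding q'_def n_def by (intro order_trans[OF sum_abs] sum_bounded_above) auto
  qed
  have g': "(g has_real_derivative 2 * k * (\<Sum>i\<in>UNIV. 2 * torque (\<theta> t) i * q' t i)) (at t within {0..})" if "t \<ge> 0" for t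
    unfolding g_def by (auto intro!: derivative_eq_intros q'[OF that] simp: mult_ac)
  have g'b: "norm (2 * k * (\<Sum>i\<in>UNIV. 2 * torque (\<theta> t) i * q' t i)) \<le> 2 * k * (n * (2 * n * (n * (2 * k * n))))" for t
  proof -
    have "\<bar>2 * torque (\<theta> t) i * q' t i\<bar> \<le> 2 * n * (n * (2 * k * n))" for i
      unfolding abs_mult using q'b[of t i] torque_bound[of "\<theta> t" i] by (intro mult_mono) (auto simp: n_def)
    then have "\<bar>\<Sum>i\<in>UNIV. 2 * torque (\<theta> t) i * q' t i\<bar> \<le> n * (2 * n * (n * (2 * k * n)))"
      unfolding n_def by (intro order_trans[OF sum_abs] sum_bounded_above) auto
    then have "2 * k * \<bar>\<Sum>i\<in>UNIV. 2 * torque (\<theta> t) i * q' t i\<bar> \<le> 2 * k * (n * (2 * n * (n * (2 * k * n))))"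
      using k by (intro mult_left_mono) auto
    then show ?thesis using k unfolding real_norm_def abs_mult by simp
  qed
  have "(g \<longlongrightarrow> 0) at_top"
  proof (rule barbalat[where V = "\<lambda>t. coherence (\<theta> t)" and g = g])
    show "0 \<le> g t" for t using k by (auto simp: g_def intro!: mult_nonneg_nonneg sum_nonneg)
    show "coherence (\<theta> t) \<le> 2 * (real CARD('n))\<^sup>2" for t by (rule coherence_bound)
    fix s t :: real assume st: "0 \<le> s" "s \<le> t"
    have "norm (g t - g s) \<le> 2 * k * (n * (2 * n * (n * (2 * k * n)))) * norm (t - s)"
      by (rule field_differentiable_bound[of "{0..}", OF _ g' g'b]) (use st in auto)
    then show "\<bar>g t - g s\<bar> \<le> 2 * k * (n * (2 * n * (n * (2 * k * n)))) * (t - s)"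
      using st by simp
  qed (use coherence_derivative in \<open>simp add: g_def\<close>)
  then have "((\<lambda>t. sqrt (g t / (2 * k))) \<longlongrightarrow> sqrt (0 / (2 * k))) at_top"
    using k by (intro tendsto_intros) auto
  then have "((\<lambda>t. sqrt (g t / (2 * k))) \<longlongrightarrow> 0) at_top" by simp
  then show ?thesis
  proof (rule Lim_null_comparison[rotated], intro always_eventually allI)
    fix t
    have "(torque (\<theta> t) i)\<^sup>2 \<le> (\<Sum>i\<in>UNIV. (torque (\<theta> t) i)\<^sup>2)"
      by (rule member_le_sum) auto
    then have "\<bar>torque (\<theta> t) i\<bar> \<le> sqrt (\<Sum>i\<in>UNIV. (torque (\<theta> t) i)\<^sup>2)"
      by (simp add: real_le_rsqrt)
    then show "norm (torque (\<theta> t) i) \<le> sqrt (g t / (2 * k))" using k by (simp add: g_def)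
  qed
qed

text \<open>
  The sum of the limiting cosines can be made positive by a common shift by \<open>\<pi>\<close>, unless it is zero.
  Zero is excluded because then the coherence, which cannot decrease, would tend to \<open>0\<close>.
\<close>

lemma phase_differences_converge:
  assumes coh: "coherence (\<theta> 0) > 0"
  shows "\<exists>m :: 'n \<Rightarrow> int. (\<forall>i j. ((\<lambda>t. \<theta> t $ j - \<theta> t $ i) \<longlongrightarrow> pi * of_int (m j) - pi * of_int (m i)) at_top)
     \<and> (\<Sum>i\<in>UNIV. cos (pi * of_int (m i))) > 0"
proof -
  define r :: 'n where "r = undefined"
  have "\<exists>m::int. ((\<lambda>t. \<theta> t $ i - \<theta> t $ r) \<longlongrightarrow> pi * of_int m) at_top" for i
  proof (rule sin_tendsto_zero_imp_tendsto)
    have "continuous_on {0..} (\<lambda>t. \<theta> t $ l)" for l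
      by (rule DERIV_continuous_on[of "{0..}"]) (use phase_derivative in auto)
    then show "continuous_on {0..} (\<lambda>t. \<theta> t $ i - \<theta> t $ r)" by (intro continuous_on_diff)
    have "((\<lambda>t. 2 * real CARD('n) * (\<bar>torque (\<theta> t) r\<bar> + \<bar>torque (\<theta> t) i\<bar>) / coherence (\<theta> 0)) \<longlongrightarrow>
        2 * real CARD('n) * (\<bar>0\<bar> + \<bar>0\<bar>) / coherence (\<theta> 0)) at_top"
      using coh by (intro tendsto_intros torque_tendsto_zero) auto
    then have lim: "((\<lambda>t. 2 * real CARD('n) * (\<bar>torque (\<theta> t) r\<bar> + \<bar>torque (\<theta> t) i\<bar>) / coherence (\<theta> 0)) \<longlongrightarrow> 0) at_top"
      by simp
    show "((\<lambda>t. sin (\<theta> t $ i - \<theta> t $ r)) \<longlongrightarrow> 0) at_top"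
    proof (rule Lim_null_comparison[OF _ lim])
      show "\<forall>\<^sub>F t in at_top. norm (sin (\<theta> t $ i - \<theta> t $ r))
          \<le> 2 * real CARD('n) * (\<bar>torque (\<theta> t) r\<bar> + \<bar>torque (\<theta> t) i\<bar>) / coherence (\<theta> 0)"
        using eventually_ge_at_top[of 0]
      proof eventually_elim
        case (elim t)
        have "coherence (\<theta> 0) * \<bar>sin (\<theta> t $ i - \<theta> t $ r)\<bar> \<le> coherence (\<theta> t) * \<bar>sin (\<theta> t $ i - \<theta> t $ r)\<bar>"
          by (intro mult_right_mono coherence_mono[OF elim]) auto
        also note sin_diff_coherence
        finally show ?case using coh by (simp add: field_simps)
      qed
    qed
  qed
  then obtain m0 :: "'n \<Rightarrow> int" where m0: "\<And>i. ((\<lambda>t. \<theta> t $ i - \<theta> t $ r) \<longlongrightarrow> pi * of_int (m0 i)) at_top"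
    by metis
  let ?\<sigma> = "\<lambda>m :: 'n \<Rightarrow> int. \<Sum>i\<in>UNIV. cos (pi * of_int (m i))"
  have diff: "((\<lambda>t. \<theta> t $ j - \<theta> t $ i) \<longlongrightarrow> pi * of_int (m0 j) - pi * of_int (m0 i)) at_top" for i j
    using tendsto_diff[OF m0[of j] m0[of i]] by simp
  have "?\<sigma> m0 \<noteq> 0"
  proof
    assume zero: "?\<sigma> m0 = 0"
    have rot: "coherence (\<theta> t) = (\<Sum>i\<in>UNIV. cos (\<theta> t $ i - \<theta> t $ r))\<^sup>2 + (\<Sum>i\<in>UNIV. sin (\<theta> t $ i - \<theta> t $ r))\<^sup>2" for t
    proof -
      let ?C = "\<Sum>j\<in>UNIV. cos (\<theta> t $ j)" and ?S = "\<Sum>j\<in>UNIV. sin (\<theta> t $ j)"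
      let ?c = "cos (\<theta> t $ r)" and ?s = "sin (\<theta> t $ r)"
      have "(\<Sum>i\<in>UNIV. cos (\<theta> t $ i - \<theta> t $ r)) = ?C * ?c + ?S * ?s"
        by (simp add: cos_diff sum.distrib sum_distrib_right)
      moreover have "(\<Sum>i\<in>UNIV. sin (\<theta> t $ i - \<theta> t $ r)) = ?S * ?c - ?C * ?s"
        by (simp add: sin_diff sum_subtractf sum_distrib_right)
      moreover have "(C * c + S * s)\<^sup>2 + (S * c - C * s)\<^sup>2 = (C\<^sup>2 + S\<^sup>2) * (s\<^sup>2 + c\<^sup>2)" for C S c s :: real
        by (simp add: algebra_simps power2_eq_square)
      ultimately show ?thesis by (simp add: coherence_def)
    qed
    have "((\<lambda>t. coherence (\<theta> t)) \<longlongrightarrow> (?\<sigma> m0)\<^sup>2 + (\<Sum>i\<in>UNIV. sin (pi * of_int (m0 i)))\<^sup>2) at_top"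
      unfolding rot by (intro tendsto_intros m0)
    then have "((\<lambda>t. coherence (\<theta> t)) \<longlongrightarrow> 0) at_top"
      by (simp only: zero sin_npi_int) simp
    moreover have "\<forall>\<^sub>F t in at_top. coherence (\<theta> 0) \<le> coherence (\<theta> t)"
      using eventually_ge_at_top[of 0] by eventually_elim (rule coherence_mono)
    ultimately have "coherence (\<theta> 0) \<le> 0"
      by (rule tendsto_lowerbound) simp
    with coh show False by simp
  qed
  then consider "?\<sigma> m0 > 0" | "?\<sigma> m0 < 0" by linarith
  then show ?thesis
  proof cases
    case 1
    then show ?thesis using diff by blast
  next
    case 2
    have "?\<sigma> (\<lambda>i. m0 i + 1) = - ?\<sigma> m0"
      unfolding sum_negf[symmetric] by (intro sum.cong refl) (simp add: distrib_left cos_add del: cos_npi_int)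
    then show ?thesis using diff 2 by (intro exI[of _ "\<lambda>i. m0 i + 1"]) (auto simp: algebra_simps)
  qed
qed

text \<open>
  An odd entry of the limit \<open>m\<close> marks a phase opposite to the majority; if all entries are even, the
  limits of the phase differences are multiples of \<open>2\<pi>\<close>. The capture time is rounded up to a
  natural number to have countably many cases.
\<close>

lemma sync_or_captured:
  assumes coh: "coherence (\<theta> 0) > 0"
  shows "(\<forall>i j. tends_to_zero_mod_2pi (\<lambda>t. \<theta> t $ j - \<theta> t $ i)) \<or>
    (\<exists>m :: 'n \<Rightarrow> int. \<exists>l T. (\<Sum>i\<in>UNIV. cos (pi * of_int (m i))) > 0 \<and> odd (m l)
      \<and> \<theta> (real T) \<in> captured a k (\<lambda>i. pi * of_int (m i)))"
proof -
  obtain m :: "'n \<Rightarrow> int" where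
    lim: "\<And>i j. ((\<lambda>t. \<theta> t $ j - \<theta> t $ i) \<longlongrightarrow> pi * of_int (m j) - pi * of_int (m i)) at_top"
    and \<sigma>: "(\<Sum>i\<in>UNIV. cos (pi * of_int (m i))) > 0"
    using phase_differences_converge[OF coh] by blast
  let ?\<epsilon> = "1 / (4 * real CARD('n))"
  show ?thesis
  proof (cases "\<exists>l. odd (m l)")
    case True
    then obtain l where l: "odd (m l)" ..
    have "\<forall>\<^sub>F t in at_top. \<forall>i j. \<bar>\<theta> t $ j - \<theta> t $ i - (pi * of_int (m j) - pi * of_int (m i))\<bar> < ?\<epsilon>"
      using tendstoD[OF lim, of ?\<epsilon>] by (auto simp: eventually_all_finite dist_real_def)
    then obtain T0 where T0: "\<And>t i j. t \<ge> T0 \<Longrightarrow>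
        \<bar>\<theta> t $ j - \<theta> t $ i - (pi * of_int (m j) - pi * of_int (m i))\<bar> < ?\<epsilon>"
      by (auto simp: eventually_at_top_linorder)
    obtain T :: nat where T: "real T \<ge> T0" using real_arch_simple by blast
    have "stays_near ?\<epsilon> (\<lambda>i. pi * of_int (m i)) (\<lambda>t. \<theta> (real T + t))"
      unfolding stays_near_def
    proof (intro allI impI less_imp_le[OF T0])
      fix t :: real assume "t \<ge> 0"
      then show "T0 \<le> real T + t" using T by linarith
    qed
    moreover have "complete_kuramoto a k (\<lambda>t. \<theta> (real T + t))" by (rule complete_kuramoto_shift[OF th]) simp
    ultimately have "\<theta> (real T) \<in> captured a k (\<lambda>i. pi * of_int (m i))"
      unfolding captured_def by (auto intro!: exI[of _ "\<lambda>t. \<theta> (real T + t)"])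
    then show ?thesis using \<sigma> l by blast
  next
    case False
    have "tends_to_zero_mod_2pi (\<lambda>t. \<theta> t $ j - \<theta> t $ i)" for i j
      unfolding tends_to_zero_mod_2pi_def
    proof (intro allI impI)
      fix \<epsilon> :: real assume "\<epsilon> > 0"
      obtain p q where pq: "m j = 2 * p" "m i = 2 * q" using False by (meson evenE)
      from tendstoD[OF lim \<open>\<epsilon> > 0\<close>, of j i]
      show "\<forall>\<^sub>F t in at_top. \<exists>m::int. \<bar>\<theta> t $ j - \<theta> t $ i - 2 * pi * of_int m\<bar> < \<epsilon>"
      proof eventually_elim
        case (elim t)
        then show ?case by (intro exI[of _ "p - q"]) (simp add: dist_real_def pq algebra_simps)
      qed
    qed
    then show ?thesis by blast
  qed
qed

end

section \<open>Almost every initial phase synchronises\<close>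

text \<open>
  Moving a single phase by less than a full turn changes \<open>Z\<close>, so \<open>Z = 0\<close> at most at one of the two
  positions.
\<close>

lemma negligible_incoherent: "negligible {x :: real ^ 'n::finite. coherence x = 0}"
proof (rule negligible_if_disjoint_translates[where v = "axis undefined 1"])
  define i :: 'n where "i = undefined"
  show "closed {x :: real ^ 'n. coherence x = 0}"
    unfolding coherence_def by (intro closed_Collect_eq continuous_intros)
  fix x :: "real ^ 'n" and \<delta> :: real
  assume x: "x \<in> {x. coherence x = 0}" and \<delta>: "0 < \<delta>" "\<delta> < 1"
  show "x + \<delta> *\<^sub>R axis undefined 1 \<notin> {x. coherence x = 0}"
  proof
    assume y: "x + \<delta> *\<^sub>R axis undefined 1 \<in> {x. coherence x = 0}"
    define y where "y = x + \<delta> *\<^sub>R axis i 1"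
    have sums: "(\<Sum>j\<in>UNIV. cos (x $ j)) = 0" "(\<Sum>j\<in>UNIV. sin (x $ j)) = 0"
      "(\<Sum>j\<in>UNIV. cos (y $ j)) = 0" "(\<Sum>j\<in>UNIV. sin (y $ j)) = 0"
      using x y by (auto simp: coherence_def y_def i_def)
    have rest: "y $ j = x $ j" if "j \<in> UNIV - {i}" for j using that by (auto simp: y_def axis_def)
    have yi: "y $ i = x $ i + \<delta>" by (simp add: y_def axis_def)
    have "cos (y $ i) = cos (x $ i)" "sin (y $ i) = sin (x $ i)"
      using sums rest by (simp_all add: sum.remove[of UNIV i])
    then have "cos (y $ i - x $ i) = 1"
      by (simp add: cos_diff flip: power2_eq_square)
    then have "cos \<delta> = 1" by (simp add: yi)
    moreover have "cos \<delta> < cos 0"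
      by (rule cos_monotone_0_pi) (use \<delta> pi_gt3 in auto)
    ultimately show False by simp
  qed
qed

theorem corollary4p1:
  fixes \<omega> :: "real ^ 'n::finite" and k :: real and A :: "real ^ 'n ^ 'n"
  assumes "complete_network A" and "homogeneous \<omega>" and "k > 0"
  shows "(\<exists>\<theta>. zero_fixed_point \<omega> k A \<theta>) \<and>
    (\<exists>N \<in> null_sets lebesgue. zero_basin \<omega> k A = phase_space - N)"
proof
  define r :: 'n where "r = undefined"
  define a where "a = \<omega> $ r"
  have \<omega>: "\<omega> $ i = a" for i using assms(2) by (auto simp: homogeneous_def a_def)
  have sol: "kuramoto_solution \<omega> k A \<theta> \<longleftrightarrow> complete_kuramoto a k \<theta>" for \<theta>
    unfolding a_def by (rule kuramoto_solution_complete_homogeneous[OF assms(1,2)])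
  have "zero_fixed_point \<omega> k A (\<lambda>t. \<chi> i. a * t)"
    unfolding zero_fixed_point_def fixed_point_def sol complete_kuramoto_def
    by (auto intro!: derivative_eq_intros exI[of _ 0] simp: mean_frequency_def \<omega>)
  then show "\<exists>\<theta>. zero_fixed_point \<omega> k A \<theta>" by blast
  let ?c = "\<lambda>m :: 'n \<Rightarrow> int. \<lambda>i. pi * of_int (m i)"
  let ?W = "\<lambda>m T. {\<theta> 0 | \<theta>. complete_kuramoto a k \<theta> \<and> \<theta> (real T) \<in> captured a k (?c m)}"
  define M where "M = {m :: 'n \<Rightarrow> int. (\<Sum>i\<in>UNIV. cos (?c m i)) > 0 \<and> (\<exists>l. odd (m l))}"
  define N where "N = phase_space - zero_basin \<omega> k A"
  have "N \<subseteq> {x. coherence x = 0} \<union> (\<Union>m\<in>M. \<Union>T. ?W m T)"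
  proof
    fix x assume x: "x \<in> N"
    then obtain \<theta> i j where \<theta>: "complete_kuramoto a k \<theta>" "\<theta> 0 = x"
      "\<not> tends_to_zero_mod_2pi (\<lambda>t. \<theta> t $ j - \<theta> t $ i)"
      using complete_kuramoto_global_solution[OF assms(3), of a x]
      unfolding N_def zero_basin_def sol by blast
    show "x \<in> {x. coherence x = 0} \<union> (\<Union>m\<in>M. \<Union>T. ?W m T)"
    proof (cases "coherence x = 0")
      case False
      then have "coherence (\<theta> 0) > 0" by (simp add: \<theta>(2) coherence_def sum_power2_gt_zero_iff)
      from sync_or_captured[OF assms(3) \<theta>(1) this] \<theta>(3) obtain m l T
        where "(\<Sum>i\<in>UNIV. cos (?c m i)) > 0" "odd (m l)" "\<theta> (real T) \<in> captured a k (?c m)"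
        by blast
      then have "m \<in> M" "x \<in> ?W m T" using \<theta> by (auto simp: M_def)
      then show ?thesis by blast
    qed simp
  qed
  moreover have "negligible (?W m T)" if m: "m \<in> M" for m T
  proof -
    obtain l where pos: "(\<Sum>i\<in>UNIV. cos (?c m i)) > 0" and "odd (m l)"
      using m unfolding M_def by blast
    then have "cos (?c m l) = -1" by (simp add: cos_npi_int)
    with pos have "negligible (captured a k (?c m))"
      by (intro negligible_captured[OF assms(3)] sin_npi_int)
    then show ?thesis
      by (intro negligible_initial_phases[OF assms(3)]) auto
  qed
  then have "negligible (\<Union>m\<in>M. \<Union>T. ?W m T)"
    by (intro negligible_countable_Union countable_image countableI_type) auto
  ultimately have "negligible N"
    using negligible_incoherent negligible_Un negligible_subset by blast
  then have "N \<in> null_sets lebesgue" by (simp add: negligible_iff_null_sets)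
  moreover have "zero_basin \<omega> k A = phase_space - N" by (auto simp: N_def zero_basin_def)
  ultimately show "\<exists>N \<in> null_sets lebesgue. zero_basin \<omega> k A = phase_space - N" by blast
qed

end
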